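(* Let $\varphi:H\to\mathbb{R}\cup\{+\infty\}$ be a convex, lower semi-continuous and proper function on a Hilbert space $H$, and let $A$ be an anti-symmetric linear operator into $H$ with domain $D(A)\subset H$ such that $D(\varphi)\subset D(A)$. Assume that $x_0\in D(A)$ and $\partial\varphi(x_0)$ is non-empty. Then, for all $\omega\in\mathbb{R}$ and all $T>0$, there exists $\bar u\in A_H^2([0,T])$ such that $$-\dot{\bar u}(t)+A\bar u(t)-\omega\bar u(t)\in\partial\varphi(\bar u(t))\quad\text{for a.e. }t\in[0,T],\qquad \bar u(0)=x_0 .$$
   Context: $D(\varphi)=\{x:\varphi(x)<+\infty\}$. A densely defined linear operator $A:D(A)\subset H\to H$ is anti-symmetric if $D(A)\subset D(A^* )$ and $A^*=-A$ on $D(A)$. $A_H^2([0,T])$ is the space of absolutely continuous arcs $u:[0,T]\to H$ with $\dot u\in L^2([0,T];H)$. $\partial\varphi$ is the convex subdifferential. *)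

theory Defs
  imports "HOL-Analysis.Analysis"
begin

section \<open>Convex functions with values in the extended reals\<close>

definition effective_domain :: "('a \<Rightarrow> ereal) \<Rightarrow> 'a set" where
  "effective_domain \<phi> = {x. \<phi> x < \<infinity>}"

text \<open>An extended real valued function that omits \<open>-\<infinity>\<close> is a function into
  \<open>\<real> \<union> {+\<infinity>}\<close>; on such functions the arithmetic below never meets \<open>\<infinity> - \<infinity>\<close>.\<close>

definition proper :: "('a \<Rightarrow> ereal) \<Rightarrow> bool" where
  "proper \<phi> \<longleftrightarrow> (\<forall>x. \<phi> x \<noteq> -\<infinity>) \<and> effective_domain \<phi> \<noteq> {}"

definition ereal_convex :: "('a::real_vector \<Rightarrow> ereal) \<Rightarrow> bool" where
  "ereal_convex \<phi> \<longleftrightarrow>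
    (\<forall>x y. \<forall>s::real. 0 < s \<and> s < 1 \<longrightarrow>
      \<phi> ((1 - s) *\<^sub>R x + s *\<^sub>R y) \<le> ereal (1 - s) * \<phi> x + ereal s * \<phi> y)"

definition lower_semicontinuous :: "('a::topological_space \<Rightarrow> ereal) \<Rightarrow> bool" where
  "lower_semicontinuous \<phi> \<longleftrightarrow> (\<forall>x. \<phi> x \<le> Liminf (at x) \<phi>)"

definition subdifferential :: "('a::real_inner \<Rightarrow> ereal) \<Rightarrow> 'a \<Rightarrow> 'a set" where
  "subdifferential \<phi> x =
    {p. x \<in> effective_domain \<phi> \<and> (\<forall>y. \<phi> x + ereal (p \<bullet> (y - x)) \<le> \<phi> y)}"

section \<open>Unbounded operators\<close>

text \<open>An unbounded operator is a pair of a domain \<open>D\<close> and a total function \<open>A\<close>, whose values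
  off \<open>D\<close> carry no meaning.\<close>

definition linear_operator_on :: "'a::real_vector set \<Rightarrow> ('a \<Rightarrow> 'a) \<Rightarrow> bool" where
  "linear_operator_on D A \<longleftrightarrow> subspace D \<and>
    (\<forall>x\<in>D. \<forall>y\<in>D. A (x + y) = A x + A y) \<and>
    (\<forall>c. \<forall>x\<in>D. A (c *\<^sub>R x) = c *\<^sub>R A x)"

definition adjoint_domain :: "'a::real_inner set \<Rightarrow> ('a \<Rightarrow> 'a) \<Rightarrow> 'a set" where
  "adjoint_domain D A = {y. \<exists>z. \<forall>x\<in>D. A x \<bullet> y = x \<bullet> z}"

text \<open>The description is well defined on \<^term>\<open>adjoint_domain D A\<close> whenever \<open>D\<close> is dense.\<close>

definition adjoint_operator :: "'a::real_inner set \<Rightarrow> ('a \<Rightarrow> 'a) \<Rightarrow> 'a \<Rightarrow> 'a" where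
  "adjoint_operator D A y = (THE z. \<forall>x\<in>D. A x \<bullet> y = x \<bullet> z)"

definition antisymmetric_operator :: "'a::real_inner set \<Rightarrow> ('a \<Rightarrow> 'a) \<Rightarrow> bool" where
  "antisymmetric_operator D A \<longleftrightarrow>
    linear_operator_on D A \<and> closure D = UNIV \<and>
    D \<subseteq> adjoint_domain D A \<and> (\<forall>y\<in>D. adjoint_operator D A y = - A y)"

section \<open>Absolutely continuous arcs with square integrable derivative\<close>

definition absolutely_continuous_arc :: "real \<Rightarrow> (real \<Rightarrow> 'a::real_normed_vector) \<Rightarrow> bool" where
  "absolutely_continuous_arc T u \<longleftrightarrow>
    (\<forall>\<epsilon>>0. \<exists>\<delta>>0. \<forall>(n::nat) a b.
      (\<forall>i<n. 0 \<le> a i \<and> a i \<le> b i \<and> b i \<le> T) \<and>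
      disjoint_family_on (\<lambda>i. {a i<..<b i}) {..<n} \<and>
      (\<Sum>i<n. b i - a i) < \<delta> \<longrightarrow>
      (\<Sum>i<n. norm (u (b i) - u (a i))) < \<epsilon>)"

text \<open>The library's Bochner integral is restricted to second countable spaces, whereas the
  Hilbert space here need not be separable; hence strong (Bochner) measurability is spelt out.\<close>

definition strongly_measurable :: "'b measure \<Rightarrow> ('b \<Rightarrow> 'a::real_normed_vector) \<Rightarrow> bool" where
  "strongly_measurable M f \<longleftrightarrow>
    (\<exists>s. (\<forall>n::nat. simple_function M (s n)) \<and> (AE t in M. (\<lambda>n. s n t) \<longlonglongrightarrow> f t))"

definition square_integrable :: "'b measure \<Rightarrow> ('b \<Rightarrow> 'a::real_normed_vector) \<Rightarrow> bool" where
  "square_integrable M f \<longleftrightarrow>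
    strongly_measurable M f \<and> integrable M (\<lambda>t. (norm (f t))\<^sup>2)"

text \<open>An arc on \<open>[0,T]\<close> is a total function of which only the values on \<open>[0,T]\<close> matter: the
  derivative is taken within \<open>{0..T}\<close>. Differentiability almost everywhere is automatic for
  absolutely continuous arcs in a Hilbert space; it is stated because
  \<^const>\<open>vector_derivative\<close> is unspecified where the derivative does not exist.\<close>

definition A2_arcs :: "real \<Rightarrow> (real \<Rightarrow> 'a::real_normed_vector) set" where
  "A2_arcs T = {u. absolutely_continuous_arc T u \<and>
    (AE t in lebesgue_on {0..T}. u differentiable (at t within {0..T})) \<and>
    square_integrable (lebesgue_on {0..T}) (\<lambda>t. vector_derivative u (at t within {0..T}))}"

end

theory Submission
  imports Defs
begin

text \<open>Put \<open>B x = \<partial>\<phi>(x) - A x\<close>. Since \<open>A\<close> is skew on the domain of \<open>\<phi>\<close>, \<open>B\<close> is monotone, and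
  \<open>x + \<mu> B x \<ni> z\<close> is solvable by a min-max argument for the strongly convex-concave function
  \<open>\<psi>(u) - \<psi>(v) - \<langle>u, A v\<rangle>\<close>; so \<open>B\<close> is maximal monotone. The scheme that is implicit in \<open>B\<close> and
  explicit in the Lipschitz term \<open>\<omega> u\<close> converges along the step sizes \<open>2\<^sup>-\<^sup>k\<close>: monotonicity makes the
  error committed on halving the step \<open>h\<close> of order \<open>\<surd>h\<close>, which is summable. The limit arc is right
  differentiable everywhere, with derivative minus a Yosida limit in \<open>B u + \<omega> u\<close>, and its speed times
  \<open>exp(- \<bar>\<omega>\<bar> t)\<close> decreases. Hence the arc is differentiable outside the countable set where the speed jumps,
  and no differentiation theorem for Lipschitz arcs is needed, even in a nonseparable space.\<close>

section \<open>Solvability of the resolvent equation\<close>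

text \<open>The obstacle is that \<open>A\<close> is unbounded, so nothing can be passed to the
  limit inside \<open>A\<close>. It is used only through pairings \<open>x \<bullet> A y\<close>,
  where skewness moves it to an argument that stays fixed, and the limit arc is tied to
  \<open>B\<close> by inequalities tested against pairs \<open>p \<in> B x\<close>, in which no
  value of \<open>A\<close> along the arc occurs. Strong convexity makes minimizing sequences
  Cauchy, so completeness does the work of weak compactness. Treating \<open>\<omega> u\<close>
  explicitly leaves the resolvent of the monotone \<open>B\<close> alone in each step, for every
  step size and either sign of \<open>\<omega>\<close>, at the price of a factor
  \<open>1 + h * \<bar>\<omega>\<bar>\<close> per step, whence the exponentials. A subgradient at
  the initial point serves twice: it gives \<open>\<phi>\<close> an affine minorant, and it makes
  the first Euler step of order \<open>h\<close>, a bound that nonexpansiveness hands on to all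
  later steps and that makes the limit Lipschitz.\<close>

lemma strongly_convex_attains_min:
  fixes f :: "'a::{real_normed_vector, complete_space} \<Rightarrow> real"
  assumes c: "c > 0" and ne: "E \<noteq> {}"
    and bdd: "\<And>x. x \<in> E \<Longrightarrow> b \<le> f x"
    and mid: "\<And>x y. x \<in> E \<Longrightarrow> y \<in> E \<Longrightarrow> (1/2) *\<^sub>R (x + y) \<in> E"
    and conv: "\<And>x y. x \<in> E \<Longrightarrow> y \<in> E \<Longrightarrow>
      f ((1/2) *\<^sub>R (x + y)) \<le> (f x + f y) / 2 - c * (norm (x - y))\<^sup>2"
    and lsc: "\<And>X x r. (\<And>n. X n \<in> E) \<Longrightarrow> X \<longlonglongrightarrow> x \<Longrightarrow> (\<lambda>n. f (X n)) \<longlonglongrightarrow> r \<Longrightarrow> x \<in> E \<and> f x \<le> r"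
  shows "\<exists>x\<in>E. \<forall>y\<in>E. f x + 2 * c * (norm (x - y))\<^sup>2 \<le> f y"
proof -
  define m where "m = Inf (f ` E)"
  have bb: "bdd_below (f ` E)" using bdd by (auto simp: bdd_below_def)
  have m_le: "m \<le> f x" if "x \<in> E" for x
    unfolding m_def by (rule cInf_lower[OF _ bb]) (use that in auto)
  have "\<exists>x\<in>E. f x < m + 1 / Suc n" for n
  proof -
    have "Inf (f ` E) < m + 1 / Suc n" unfolding m_def by simp
    then show ?thesis using cInf_less_iff[OF _ bb] ne by auto
  qed
  then obtain X where X: "\<And>n. X n \<in> E" and fX: "\<And>n. f (X n) < m + 1 / Suc n" by metis
  \<comment> \<open>The midpoint of two near-minimizers cannot fall below the infimum, so strong
    convexity turns near-minimality into closeness.\<close>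
  have dist2: "2 * c * (norm (X i - X j))\<^sup>2 \<le> 1 / Suc i + 1 / Suc j" for i j
  proof -
    have "m \<le> (f (X i) + f (X j)) / 2 - c * (norm (X i - X j))\<^sup>2"
      using m_le[OF mid[OF X X]] conv[OF X X] by (rule order_trans)
    then have "2 * (c * (norm (X i - X j))\<^sup>2) \<le> (f (X i) - m) + (f (X j) - m)" by argo
    also have "\<dots> \<le> 1 / Suc i + 1 / Suc j" using fX[of i] fX[of j] by (intro add_mono) argo+
    finally show ?thesis by (simp only: mult.assoc)
  qed
  have "Cauchy X"
  proof (rule metric_CauchyI)
    fix e :: real assume e: "e > 0"
    obtain N where N: "1 / Suc N < c * e\<^sup>2"
      using nat_approx_posE[of "c * e\<^sup>2"] c e by (metis mult_pos_pos zero_less_power)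
    show "\<exists>M. \<forall>i\<ge>M. \<forall>j\<ge>M. dist (X i) (X j) < e"
    proof (intro exI allI impI)
      fix i j assume ij: "i \<ge> N" "j \<ge> N"
      have "1 / Suc i \<le> 1 / Suc N" "1 / Suc j \<le> 1 / Suc N" using ij by (auto simp: frac_le)
      then have "2 * c * (norm (X i - X j))\<^sup>2 < 2 * (c * e\<^sup>2)"
        using dist2[of i j] N by linarith
      then have "(norm (X i - X j))\<^sup>2 < e\<^sup>2" using c by simp
      then show "dist (X i) (X j) < e"
        unfolding dist_norm using e by (meson less_imp_le power_less_imp_less_base)
    qed
  qed
  then obtain x where x: "X \<longlonglongrightarrow> x" using Cauchy_convergent_iff convergent_def by blast
  have "(\<lambda>n. f (X n)) \<longlonglongrightarrow> m"
  proof (rule tendsto_sandwich)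
    show "(\<lambda>n. m) \<longlonglongrightarrow> m" by simp
    show "(\<lambda>n. m + 1 / Suc n) \<longlonglongrightarrow> m"
      using tendsto_add[OF tendsto_const[of m] LIMSEQ_inverse_real_of_nat]
      by (simp add: inverse_eq_divide)
    show "\<forall>\<^sub>F n in sequentially. m \<le> f (X n)" using m_le X by simp
    show "\<forall>\<^sub>F n in sequentially. f (X n) \<le> m + 1 / Suc n" using fX by (simp add: less_imp_le)
  qed
  from lsc[OF X x this] have xE: "x \<in> E" and fx: "f x \<le> m" by auto
  show ?thesis
  proof (intro bexI[OF _ xE] ballI)
    fix y assume y: "y \<in> E"
    \<comment> \<open>The same midpoint test between the minimizer and \<open>y\<close> gives
      quadratic growth, more than mere minimality; this gap later controls how maximizers
      move.\<close>
    have "f x \<le> (f x + f y) / 2 - c * (norm (x - y))\<^sup>2"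
      using fx m_le[OF mid[OF xE y]] conv[OF xE y] by linarith
    then show "f x + 2 * c * (norm (x - y))\<^sup>2 \<le> f y" by (simp add: field_simps)
  qed
qed

text \<open>The conclusion says that \<open>(1/\<mu>) *\<^sub>R (z - x) + A x\<close> is a
  subgradient of \<open>f\<close> at \<open>x\<close>, that is,
  \<open>z = x + \<mu> *\<^sub>R q\<close> with \<open>q + A x\<close> a subgradient. Semicontinuity
  is phrased with majorants \<open>g n\<close> because the values \<open>f (X n)\<close> themselves
  need not converge when only a bound on them is known.\<close>

lemma monotone_skew_range:
  fixes f :: "'a::{real_inner, complete_space} \<Rightarrow> real"
  assumes lam: "\<mu> > 0" and ne: "E \<noteq> {}"
    and minor: "\<And>x. x \<in> E \<Longrightarrow> b + p \<bullet> x \<le> f x"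
    and cE: "\<And>x y s. x \<in> E \<Longrightarrow> y \<in> E \<Longrightarrow> 0 < s \<Longrightarrow> s < 1 \<Longrightarrow> x + s *\<^sub>R (y - x) \<in> E"
    and conv: "\<And>x y s. x \<in> E \<Longrightarrow> y \<in> E \<Longrightarrow> 0 < s \<Longrightarrow> s < 1 \<Longrightarrow>
      f (x + s *\<^sub>R (y - x)) \<le> (1 - s) * f x + s * f y"
    and lsc: "\<And>X x g r. (\<And>n. X n \<in> E) \<Longrightarrow> X \<longlonglongrightarrow> x \<Longrightarrow> (\<And>n. f (X n) \<le> g n) \<Longrightarrow> g \<longlonglongrightarrow> r
      \<Longrightarrow> x \<in> E \<and> f x \<le> r"
    and skew: "\<And>x y. x \<in> E \<Longrightarrow> y \<in> E \<Longrightarrow> A x \<bullet> y = - (x \<bullet> A y)"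
  shows "\<exists>x\<in>E. \<forall>y\<in>E. f x + ((1/\<mu>) *\<^sub>R (z - x) + A x) \<bullet> (y - x) \<le> f y"
proof -
  \<comment> \<open>With this factor the gradient of
    \<open>\<kappa> * (norm (x - z))\<^sup>2\<close> is \<open>(1/\<mu>) *\<^sub>R (x - z)\<close>,
    the resolvent term.\<close>
  define \<kappa> where "\<kappa> = 1 / (2 * \<mu>)"
  have k: "\<kappa> > 0" and k2: "1/\<mu> = 2 * \<kappa>" using lam by (auto simp: \<kappa>_def)
  define \<psi> where "\<psi> x = f x + \<kappa> * (norm (x - z))\<^sup>2" for x
  have half: "x + (1/2) *\<^sub>R (y - x) = (1/2) *\<^sub>R (x + y)" for x y :: 'a
    by (rule scaleR_left_imp_eq[of 2]) (simp_all add: scaleR_add_right scaleR_diff_right scaleR_2)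
  have midE: "(1/2) *\<^sub>R (x + y) \<in> E" if "x \<in> E" "y \<in> E" for x y
    using cE[OF that, of "1/2"] by (simp add: half)
  have mid\<psi>: "\<psi> ((1/2) *\<^sub>R (x + y)) \<le> (\<psi> x + \<psi> y) / 2 - \<kappa>/4 * (norm (x - y))\<^sup>2"
    if "x \<in> E" "y \<in> E" for x y
  proof -
    have e: "(norm ((1/2) *\<^sub>R (x + y) - z))\<^sup>2
        = ((norm (x - z))\<^sup>2 + (norm (y - z))\<^sup>2) / 2 - (norm (x - y))\<^sup>2 / 4"
      by (simp add: power2_norm_eq_inner inner_diff_left inner_diff_right inner_add_left
          inner_add_right inner_commute field_simps)
    have "f ((1/2) *\<^sub>R (x + y)) \<le> (f x + f y) / 2"
      using conv[OF that, of "1/2"] by (simp add: half)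
    then show ?thesis unfolding \<psi>_def e by argo
  qed
  have lsc\<psi>: "x \<in> E \<and> \<psi> x \<le> r"
    if "\<And>n. X n \<in> E" "X \<longlonglongrightarrow> x" "\<And>n. \<psi> (X n) \<le> g n" "g \<longlonglongrightarrow> r" for X x g r
  proof -
    have "(\<lambda>n. g n - \<kappa> * (norm (X n - z))\<^sup>2) \<longlonglongrightarrow> r - \<kappa> * (norm (x - z))\<^sup>2"
      by (intro tendsto_intros that)
    moreover have "f (X n) \<le> g n - \<kappa> * (norm (X n - z))\<^sup>2" for n
      using that(3)[of n] by (simp add: \<psi>_def)
    ultimately have "x \<in> E \<and> f x \<le> r - \<kappa> * (norm (x - z))\<^sup>2"
      by (intro lsc[OF that(1,2)])
    then show ?thesis by (simp add: \<psi>_def)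
  qed
  \<comment> \<open>The lower bound comes from completing the square in \<open>(p - a) \<bullet> (x
    - z) + \<kappa> * (norm (x - z))\<^sup>2\<close>.\<close>
  have tilt: "\<exists>v\<in>E. \<forall>y\<in>E. (\<psi> v - a \<bullet> v) + 2 * (\<kappa>/4) * (norm (v - y))\<^sup>2 \<le> \<psi> y - a \<bullet> y" for a
  proof (rule strongly_convex_attains_min[where b = "b + (p - a) \<bullet> z - (norm (p - a))\<^sup>2 / (4 * \<kappa>)"])
    fix x assume x: "x \<in> E"
    have sq: "(norm (q + (2 * \<kappa>) *\<^sub>R w))\<^sup>2 = (norm q)\<^sup>2 + 4 * \<kappa> * (q \<bullet> w) + 4 * \<kappa>\<^sup>2 * (norm w)\<^sup>2" for q w :: 'a
      unfolding power2_norm_eq_inner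
      by (simp add: inner_add_left inner_add_right inner_commute[of w q] power2_eq_square algebra_simps)
    have "0 \<le> (norm ((p - a) + (2 * \<kappa>) *\<^sub>R (x - z)))\<^sup>2 / (4 * \<kappa>)" using k by simp
    also have "\<dots> = (norm (p - a))\<^sup>2 / (4 * \<kappa>) + (p - a) \<bullet> (x - z) + \<kappa> * (norm (x - z))\<^sup>2"
      unfolding sq using k by (simp add: add_divide_distrib power2_eq_square)
    finally show "b + (p - a) \<bullet> z - (norm (p - a))\<^sup>2 / (4 * \<kappa>) \<le> \<psi> x - a \<bullet> x"
      using minor[OF x] by (simp add: \<psi>_def inner_diff_left inner_diff_right)
  next
    fix x y assume "x \<in> E" "y \<in> E"
    from mid\<psi>[OF this] show "\<psi> ((1/2) *\<^sub>R (x + y)) - a \<bullet> ((1/2) *\<^sub>R (x + y))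
      \<le> (\<psi> x - a \<bullet> x + (\<psi> y - a \<bullet> y)) / 2 - \<kappa>/4 * (norm (x - y))\<^sup>2"
      by (simp add: inner_add_right field_simps)
  next
    fix X x r assume X: "\<And>n. X n \<in> E" "X \<longlonglongrightarrow> x" and r: "(\<lambda>n. \<psi> (X n) - a \<bullet> X n) \<longlonglongrightarrow> r"
    have "(\<lambda>n. (\<psi> (X n) - a \<bullet> X n) + a \<bullet> X n) \<longlonglongrightarrow> r + a \<bullet> x"
      by (intro tendsto_intros X r)
    then have "x \<in> E \<and> \<psi> x \<le> r + a \<bullet> x" by (intro lsc\<psi>[OF X]) auto
    then show "x \<in> E \<and> \<psi> x - a \<bullet> x \<le> r" by simp
  qed (use k ne midE in auto)
  obtain V where VE: "\<And>u. V u \<in> E" and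
    Vmin: "\<And>u y. y \<in> E \<Longrightarrow> \<psi> (V u) - A u \<bullet> V u + 2 * (\<kappa>/4) * (norm (V u - y))\<^sup>2 \<le> \<psi> y - A u \<bullet> y"
  proof -
    have "\<exists>V. \<forall>u. V u \<in> E \<and> (\<forall>y\<in>E. \<psi> (V u) - A u \<bullet> V u + 2 * (\<kappa>/4) * (norm (V u - y))\<^sup>2
      \<le> \<psi> y - A u \<bullet> y)"
      by (rule choice) (use tilt in blast)
    then show thesis using that by blast
  qed
  txt \<open>On \<open>E\<close> the function \<open>M\<close> is antisymmetric, strongly convex in the first argument and strongly
    concave in the second, and \<open>V u\<close> maximizes \<open>M u\<close>. If \<open>u\<close> minimizes \<open>I\<close>, comparing \<open>I u\<close> with \<open>I\<close> along the
    segment from \<open>u\<close> to \<open>v = V u\<close> shows \<open>I u \<le> M v v = 0\<close>, that is, \<open>A u\<close> is a subgradient of \<open>\<psi>\<close> at \<open>u\<close>.\<close>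
  define M where "M u v = \<psi> u - \<psi> v + A u \<bullet> v" for u v
  define I where "I u = M u (V u)" for u
  have MI: "M u v + \<kappa>/2 * (norm (V u - v))\<^sup>2 \<le> I u" if "v \<in> E" for u v
    using Vmin[OF that, of u] by (simp add: M_def I_def)
  have MI0: "M u v \<le> I u" if "v \<in> E" for u v
    using MI[OF that, of u] k by (smt (verit) divide_nonneg_nonneg mult_nonneg_nonneg zero_le_power2)
  have skew0: "A u \<bullet> u = 0" if "u \<in> E" for u
    using skew[OF that that] by (simp add: inner_commute)
  have I0: "0 \<le> I u" if "u \<in> E" for u
    using MI0[OF that, of u] skew0[OF that] by (simp add: M_def)
  have M_alt: "M u v = \<psi> u - \<psi> v - u \<bullet> A v" if "u \<in> E" "v \<in> E" for u v
    using skew[OF that] by (simp add: M_def)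
  \<comment> \<open>\<open>I\<close> is the pointwise maximum over \<open>v\<close> of
    \<open>M u v\<close>, and for fixed \<open>v\<close> skewness makes \<open>M u v\<close> equal
    to \<open>\<psi> u\<close> minus a continuous affine function of \<open>u\<close>. Hence
    \<open>I\<close> inherits the convexity modulus and the semicontinuity of \<open>\<psi>\<close>,
    although \<open>u \<mapsto> A u\<close> need not be continuous.\<close>
  have "\<exists>u\<in>E. \<forall>y\<in>E. I u + 2 * (\<kappa>/4) * (norm (u - y))\<^sup>2 \<le> I y"
  proof (rule strongly_convex_attains_min[where b = 0])
    fix x y assume xy: "x \<in> E" "y \<in> E"
    let ?w = "(1/2) *\<^sub>R (x + y)"
    have "I ?w = \<psi> ?w - \<psi> (V ?w) - ?w \<bullet> A (V ?w)"
      unfolding I_def by (rule M_alt[OF midE[OF xy] VE])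
    also have "\<dots> \<le> (M x (V ?w) + M y (V ?w)) / 2 - \<kappa>/4 * (norm (x - y))\<^sup>2"
      using mid\<psi>[OF xy] by (simp add: M_alt xy VE inner_add_left field_simps)
    finally show "I ?w \<le> (I x + I y) / 2 - \<kappa>/4 * (norm (x - y))\<^sup>2"
      using MI0[OF VE, of x ?w] MI0[OF VE, of y ?w] by argo
  next
    fix X x r assume X: "\<And>n. X n \<in> E" "X \<longlonglongrightarrow> x" and r: "(\<lambda>n. I (X n)) \<longlonglongrightarrow> r"
    have *: "x \<in> E \<and> \<psi> x \<le> r + \<psi> v + x \<bullet> A v" if v: "v \<in> E" for v
    proof (rule lsc\<psi>[OF X])
      show "\<psi> (X n) \<le> I (X n) + \<psi> v + X n \<bullet> A v" for n
        using MI0[OF v, of "X n"] M_alt[OF X(1) v, of n] by simp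
      show "(\<lambda>n. I (X n) + \<psi> v + X n \<bullet> A v) \<longlonglongrightarrow> r + \<psi> v + x \<bullet> A v"
        by (intro tendsto_intros X r)
    qed
    then have "x \<in> E" using ne by blast
    moreover have "I x \<le> r"
      using *[OF VE, of x] M_alt[OF \<open>x \<in> E\<close> VE, of x] by (simp add: I_def)
    ultimately show "x \<in> E \<and> I x \<le> r" ..
  qed (use k ne midE I0 in auto)
  then obtain u where u: "u \<in> E" and umin: "\<And>y. y \<in> E \<Longrightarrow> I u \<le> I y"
    using k by (smt (verit) divide_nonneg_nonneg mult_nonneg_nonneg zero_le_power2)
  define v where "v = V u"
  have v: "v \<in> E" by (simp add: v_def VE)
  \<comment> \<open>The shift by 2 keeps \<open>1 - t n\<close> at least \<open>1/2\<close>, so this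
    factor can be divided out below.\<close>
  define t where "t n = 1 / (real n + 2)" for n
  have t: "0 < t n" "t n \<le> 1/2" "t n < 1" for n by (auto simp: t_def field_simps)
  have t0: "t \<longlonglongrightarrow> 0"
    unfolding t_def by real_asymp
  define w where "w n = V (u + t n *\<^sub>R (v - u))" for n
  have wE: "w n \<in> E" for n by (simp add: w_def VE)
  have step: "I u \<le> (1 - t n) * M u (w n) + t n * M v (w n)" for n
  proof -
    let ?u = "u + t n *\<^sub>R (v - u)"
    have uE: "?u \<in> E" using cE[OF u v t(1,3)] .
    have "(norm (?u - z))\<^sup>2 = (1 - t n) * (norm (u - z))\<^sup>2 + t n * (norm (v - z))\<^sup>2
        - t n * (1 - t n) * (norm (u - v))\<^sup>2"
      by (simp add: power2_norm_eq_inner inner_diff_left inner_diff_right inner_add_left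
          inner_add_right inner_commute algebra_simps)
    also have "\<dots> \<le> (1 - t n) * (norm (u - z))\<^sup>2 + t n * (norm (v - z))\<^sup>2"
      using t(1,3)[of n] by simp
    finally have "\<kappa> * (norm (?u - z))\<^sup>2 \<le> \<kappa> * ((1 - t n) * (norm (u - z))\<^sup>2 + t n * (norm (v - z))\<^sup>2)"
      using k by simp
    then have "\<psi> ?u \<le> (1 - t n) * \<psi> u + t n * \<psi> v"
      using conv[OF u v t(1,3), of n] by (simp add: \<psi>_def algebra_simps)
    moreover have "I u \<le> M ?u (w n)" using umin[OF uE] by (simp add: I_def w_def)
    moreover have "?u \<bullet> A (w n) = (1 - t n) * (u \<bullet> A (w n)) + t n * (v \<bullet> A (w n))"
      by (simp add: inner_add_left inner_diff_left algebra_simps)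
    ultimately have "I u \<le> (1 - t n) * \<psi> u + t n * \<psi> v - \<psi> (w n)
        - ((1 - t n) * (u \<bullet> A (w n)) + t n * (v \<bullet> A (w n)))"
      unfolding M_alt[OF uE wE] by linarith
    then show ?thesis unfolding M_alt[OF u wE] M_alt[OF v wE] by (simp add: algebra_simps)
  qed
  \<comment> \<open>Moving \<open>u\<close> by a fraction \<open>t n\<close> towards
    \<open>v\<close> leaves room of order \<open>t n\<close> only, and the quadratic gap in
    \<open>MI\<close> must fit into it; so the maximizers \<open>w n\<close> converge to
    \<open>v\<close>.\<close>
  have wv: "(norm (v - w n))\<^sup>2 \<le> t n * (4 * (I v - I u) / \<kappa>)" for n
  proof -
    have "(1 - t n) * M u (w n) \<le> (1 - t n) * (I u - \<kappa>/2 * (norm (v - w n))\<^sup>2)"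
      using MI[OF wE, of u n] t(3)[of n] by (simp add: v_def)
    moreover have "t n * M v (w n) \<le> t n * I v"
      using MI0[OF wE, of v n] t(1)[of n] by simp
    ultimately have up: "(1 - t n) * (\<kappa>/2 * (norm (v - w n))\<^sup>2) \<le> t n * (I v - I u)"
      using step[of n] by (simp add: algebra_simps)
    have "(1/2) * (\<kappa>/2 * (norm (v - w n))\<^sup>2) \<le> (1 - t n) * (\<kappa>/2 * (norm (v - w n))\<^sup>2)"
      using t(2)[of n] k by (intro mult_right_mono) auto
    from order_trans[OF this up] show ?thesis using k by (simp add: field_simps)
  qed
  have "(\<lambda>n. (norm (v - w n))\<^sup>2) \<longlonglongrightarrow> 0"
  proof (rule tendsto_sandwich[of "\<lambda>_. 0"])
    show "(\<lambda>n. t n * (4 * (I v - I u) / \<kappa>)) \<longlonglongrightarrow> 0" using tendsto_mult_left_zero[OF t0] .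
  qed (use wv in auto)
  then have "(\<lambda>n. sqrt ((norm (v - w n))\<^sup>2)) \<longlonglongrightarrow> sqrt 0" by (rule tendsto_real_sqrt)
  then have "(\<lambda>n. v - w n) \<longlonglongrightarrow> 0" by (simp add: tendsto_norm_zero_iff)
  then have wlim: "w \<longlonglongrightarrow> v" using tendsto_diff[OF tendsto_const[of v]] by fastforce
  have "v \<in> E \<and> \<psi> v \<le> \<psi> v + A v \<bullet> v - I u"
  proof (rule lsc\<psi>[OF wE wlim])
    show "(\<lambda>n. \<psi> v + A v \<bullet> w n - I u) \<longlonglongrightarrow> \<psi> v + A v \<bullet> v - I u"
      by (intro tendsto_intros wlim)
    fix n
    have "(1 - t n) * M u (w n) \<le> (1 - t n) * I u"
      using MI0[OF wE, of u n] t(3)[of n] by simp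
    then have "t n * I u \<le> t n * M v (w n)"
      using step[of n] by (simp add: algebra_simps)
    then show "\<psi> (w n) \<le> \<psi> v + A v \<bullet> w n - I u" using t(1)[of n] by (simp add: M_def)
  qed
  then have Iu: "I u \<le> 0" using skew0[OF v] by simp
  have sub: "\<psi> u + A u \<bullet> y \<le> \<psi> y" if "y \<in> E" for y
    using MI0[OF that, of u] Iu by (simp add: M_def)
  show ?thesis
  proof (intro bexI[OF _ u] ballI)
    fix y assume y: "y \<in> E"
    \<comment> \<open>Testing \<open>sub\<close> on the segment from \<open>u\<close> to
      \<open>y\<close> and dividing by \<open>t n\<close> replaces the quadratic part of
      \<open>\<psi>\<close> by its derivative at \<open>u\<close>; the remainder vanishes with
      \<open>t n\<close>.\<close>
    have "A u \<bullet> (y - u) - (2 * \<kappa>) * ((u - z) \<bullet> (y - u)) \<le> f y - f u + t n * (\<kappa> * (norm (y - u))\<^sup>2)" for n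
    proof -
      let ?w = "u + t n *\<^sub>R (y - u)"
      have "\<psi> u + t n * (A u \<bullet> (y - u)) \<le> \<psi> ?w"
        using sub[OF cE[OF u y t(1,3)], of n] skew0[OF u] by (simp add: inner_add_right)
      also have "\<psi> ?w \<le> (1 - t n) * f u + t n * f y + \<kappa> * (norm (?w - z))\<^sup>2"
        unfolding \<psi>_def using conv[OF u y t(1,3), of n] by simp
      also have "(norm (?w - z))\<^sup>2 = (norm (u - z))\<^sup>2 + t n * (2 * ((u - z) \<bullet> (y - u)) + t n * (norm (y - u))\<^sup>2)"
        by (simp add: power2_norm_eq_inner inner_diff_left inner_diff_right inner_add_left
          inner_add_right inner_commute algebra_simps)
      finally have "t n * (A u \<bullet> (y - u) - (2 * \<kappa>) * ((u - z) \<bullet> (y - u)))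
        \<le> t n * (f y - f u + t n * (\<kappa> * (norm (y - u))\<^sup>2))"
        by (simp add: \<psi>_def algebra_simps)
      then show ?thesis using t(1)[of n] by (simp only: mult_le_cancel_left_pos)
    qed
    moreover have "(\<lambda>n. f y - f u + t n * (\<kappa> * (norm (y - u))\<^sup>2)) \<longlonglongrightarrow> f y - f u + 0 * (\<kappa> * (norm (y - u))\<^sup>2)"
      by (intro tendsto_intros t0)
    ultimately have "A u \<bullet> (y - u) - (2 * \<kappa>) * ((u - z) \<bullet> (y - u)) \<le> f y - f u + 0 * (\<kappa> * (norm (y - u))\<^sup>2)"
      using LIMSEQ_le_const by blast
    then show "f u + ((1/\<mu>) *\<^sub>R (z - u) + A u) \<bullet> (y - u) \<le> f y"
      unfolding k2 by (simp add: inner_add_left inner_diff_left algebra_simps)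
  qed
qed

section \<open>Maximal monotone operators\<close>

locale maximal_monotone =
  fixes B :: "'a::{real_inner, complete_space} \<Rightarrow> 'a set"
  assumes mono: "p \<in> B x \<Longrightarrow> q \<in> B y \<Longrightarrow> 0 \<le> (p - q) \<bullet> (x - y)"
    and range: "\<mu> > 0 \<Longrightarrow> \<exists>x. \<exists>p\<in>B x. x + \<mu> *\<^sub>R p = z"
begin

text \<open>Minty's argument: the resolvent equation with right side \<open>x + p\<close> has a
  solution pair \<open>(y, q)\<close>, and monotonicity against it, kept in the limit, forces
  \<open>p = q\<close> and hence \<open>x = y\<close>.\<close>

lemma closed_graph:
  assumes "X \<longlonglongrightarrow> x" "P \<longlonglongrightarrow> p" "\<And>n. P n \<in> B (X n)"
  shows "p \<in> B x"
proof -
  obtain y q where q: "q \<in> B y" and eq: "y + 1 *\<^sub>R q = x + p" using range[of 1] by fastforce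
  have "(\<lambda>n. (P n - q) \<bullet> (X n - y)) \<longlonglongrightarrow> (p - q) \<bullet> (x - y)"
    by (intro tendsto_intros assms)
  then have "0 \<le> (p - q) \<bullet> (x - y)"
    by (rule LIMSEQ_le_const) (use mono[OF assms(3) q] in auto)
  also have "x - y = - (p - q)" using eq by (simp add: algebra_simps)
  finally have "(norm (p - q))\<^sup>2 \<le> 0"
    unfolding power2_norm_eq_inner by (simp only: inner_minus_right neg_0_le_iff_le)
  then have "p = q" by simp
  with eq q show ?thesis by simp
qed

text \<open>Monotonicity makes the cross term nonnegative, and Cauchy-Schwarz does the rest. With
  equal right sides it also gives uniqueness for the resolvent equation.\<close>

lemma resolvent_nonexpansive:
  assumes "p \<in> B x" "q \<in> B y" "h \<ge> 0"
  shows "norm (x - y) \<le> norm ((x + h *\<^sub>R p) - (y + h *\<^sub>R q))"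
proof -
  have "(norm (x - y))\<^sup>2 \<le> (x - y) \<bullet> ((x + h *\<^sub>R p) - (y + h *\<^sub>R q))"
    using mult_nonneg_nonneg[OF assms(3) mono[OF assms(1,2)]]
    by (simp add: power2_norm_eq_inner inner_diff_left inner_diff_right inner_add_left
        inner_add_right inner_commute algebra_simps)
  also have "\<dots> \<le> norm (x - y) * norm ((x + h *\<^sub>R p) - (y + h *\<^sub>R q))"
    by (rule norm_cauchy_schwarz)
  finally show ?thesis
    by (metis mult_left_le_imp_le norm_ge_zero norm_le_zero_iff not_le power2_eq_square order_trans)
qed

text \<open>Needed with \<open>c = \<omega> *\<^sub>R trajectory s\<close>: freezing the Lipschitz
  term at one point keeps the operator monotone, whereas adding \<open>\<omega>\<close> times the
  identity would not when \<open>\<omega> < 0\<close>.\<close>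

lemma shift: "maximal_monotone (\<lambda>x. {p. p - c \<in> B x})"
proof
  show "0 \<le> (p - q) \<bullet> (x - y)" if "p \<in> {p. p - c \<in> B x}" "q \<in> {p. p - c \<in> B y}" for p q x y
    using mono[of "p - c" x "q - c" y] that by simp
  show "\<exists>x. \<exists>p\<in>{p. p - c \<in> B x}. x + \<mu> *\<^sub>R p = z" if l: "\<mu> > 0" for \<mu> :: real and z
  proof -
    obtain x p where "p \<in> B x" "x + \<mu> *\<^sub>R p = z - \<mu> *\<^sub>R c" using range[OF l] by blast
    then show ?thesis by (intro exI[of _ x] bexI[of _ "p + c"]) (auto simp: algebra_simps)
  qed
qed

text \<open>The Yosida approximations \<open>P n\<close> of parameter \<open>1 / (n + 1)\<close> have increasing norms, and
  monotonicity bounds \<open>\<parallel>P n - P m\<parallel>\<^sup>2\<close> by the increment of the squared norms; so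
  boundedness alone yields strong convergence.\<close>

lemma yosida_converges:
  assumes bound: "\<And>\<mu> y p. \<mu> > 0 \<Longrightarrow> p \<in> B y \<Longrightarrow> y + \<mu> *\<^sub>R p = x \<Longrightarrow> norm p \<le> K"
  shows "\<exists>g P Y l. g \<in> B x \<and> P \<longlonglongrightarrow> g \<and>
    (\<forall>n. P n \<in> B (Y n) \<and> x - Y n = l n *\<^sub>R P n \<and> l n > (0::real))"
proof -
  define l where "l n = 1 / real (Suc n)" for n
  have l: "l n > 0" for n by (simp add: l_def)
  have "\<exists>y p. p \<in> B y \<and> y + l n *\<^sub>R p = x" for n using range[OF l] by blast
  then obtain Y P where P: "\<And>n. P n \<in> B (Y n)" and YP: "\<And>n. Y n + l n *\<^sub>R P n = x" by metis
  have diff: "x - Y n = l n *\<^sub>R P n" for n using YP[of n] by (simp add: algebra_simps)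
  have bd: "norm (P n) \<le> K" for n using bound[OF l P YP] .
  have main: "(norm (P n - P m))\<^sup>2 \<le> (norm (P n))\<^sup>2 - (norm (P m))\<^sup>2" if "m < n" for m n
  proof -
    have lt: "l n < l m" using that by (simp add: l_def frac_less2)
    have "0 \<le> (P n - P m) \<bullet> (Y n - Y m)" by (rule mono[OF P P])
    also have "Y n - Y m = l m *\<^sub>R P m - l n *\<^sub>R P n" using diff[of n] diff[of m] by (simp add: algebra_simps)
    \<comment> \<open>Symmetrization: \<open>l m *\<^sub>R P m - l n *\<^sub>R P n\<close> is half
      of \<open>(l m - l n) *\<^sub>R (P n + P m) - (l m + l n) *\<^sub>R (P n - P
      m)\<close>.\<close>
    finally have 1: "(l m + l n) * (norm (P n - P m))\<^sup>2 \<le> (l m - l n) * ((norm (P n))\<^sup>2 - (norm (P m))\<^sup>2)"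
      by (simp add: power2_norm_eq_inner inner_diff_left inner_diff_right inner_add_left
        inner_add_right inner_commute algebra_simps)
    moreover have "0 \<le> (l m + l n) * (norm (P n - P m))\<^sup>2" using l[of m] l[of n] by simp
    ultimately have "0 \<le> (norm (P n))\<^sup>2 - (norm (P m))\<^sup>2"
      using lt by (metis diff_gt_0_iff_gt order_trans zero_le_mult_iff not_le)
    then have "(l m - l n) * ((norm (P n))\<^sup>2 - (norm (P m))\<^sup>2)
        \<le> (l m + l n) * ((norm (P n))\<^sup>2 - (norm (P m))\<^sup>2)"
      using l[of n] by (intro mult_right_mono) auto
    with 1 have "(l m + l n) * (norm (P n - P m))\<^sup>2 \<le> (l m + l n) * ((norm (P n))\<^sup>2 - (norm (P m))\<^sup>2)"
      by linarith
    then show ?thesis using l[of m] l[of n] by (simp add: mult_le_cancel_left_pos)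
  qed
  have "incseq (\<lambda>n. (norm (P n))\<^sup>2)"
  proof (rule incseq_SucI)
    show "(norm (P n))\<^sup>2 \<le> (norm (P (Suc n)))\<^sup>2" for n
      using main[of n "Suc n"] zero_le_power2[of "norm (P (Suc n) - P n)"] by linarith
  qed
  moreover have "(norm (P n))\<^sup>2 \<le> K\<^sup>2" for n using bd by (simp add: power_mono)
  ultimately have "convergent (\<lambda>n. (norm (P n))\<^sup>2)"
    by (metis incseq_convergent convergent_def)
  then have cau: "Cauchy (\<lambda>n. (norm (P n))\<^sup>2)" by (rule convergent_Cauchy)
  have "Cauchy P"
  proof (rule metric_CauchyI)
    fix e :: real assume e: "e > 0"
    then obtain N where N: "\<And>m n. m \<ge> N \<Longrightarrow> n \<ge> N \<Longrightarrow> dist ((norm (P m))\<^sup>2) ((norm (P n))\<^sup>2) < e\<^sup>2"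
      using cau by (metis metric_CauchyD zero_less_power)
    have lt: "dist (P n) (P m) < e" if "m \<ge> N" "m < n" for m n
    proof -
      have "(norm (P n - P m))\<^sup>2 < e\<^sup>2"
        using main[OF that(2)] N[of n m] that by (simp add: dist_real_def)
      then show ?thesis unfolding dist_norm using e by (meson less_imp_le power_less_imp_less_base)
    qed
    have "dist (P m) (P n) < e" if "m \<ge> N" "n \<ge> N" for m n
      using lt[of m n] lt[of n m] that e by (cases m n rule: linorder_cases) (auto simp: dist_commute)
    then show "\<exists>M. \<forall>m\<ge>M. \<forall>n\<ge>M. dist (P m) (P n) < e" by blast
  qed
  then obtain g where g: "P \<longlonglongrightarrow> g" using Cauchy_convergent_iff convergent_def by blast
  have l0: "l \<longlonglongrightarrow> 0" unfolding l_def using LIMSEQ_inverse_real_of_nat by (simp add: inverse_eq_divide)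
  have "(\<lambda>n. x - l n *\<^sub>R P n) \<longlonglongrightarrow> x - 0 *\<^sub>R g" by (intro tendsto_intros l0 g)
  moreover have "(\<lambda>n. x - l n *\<^sub>R P n) = Y" using YP by (auto simp: algebra_simps fun_eq_iff)
  ultimately have "Y \<longlonglongrightarrow> x" by simp
  from closed_graph[OF this g P] have "g \<in> B x" .
  then show ?thesis using g P diff l by blast
qed

end

section \<open>The implicit Euler scheme\<close>

lemma Cauchy_if_summable_increments:
  fixes X :: "nat \<Rightarrow> 'a::real_normed_vector"
  assumes X: "\<And>k. norm (X (Suc k) - X k) \<le> b k" and b: "summable b"
  shows "Cauchy X"
proof (rule metric_CauchyI)
  fix e :: real assume "e > 0"
  then obtain N where N: "\<And>m n. m \<ge> N \<Longrightarrow> norm (sum b {m..<n}) < e"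
    using b unfolding summable_Cauchy by blast
  have tel: "norm (X n - X m) \<le> sum b {m..<n}" if "m \<le> n" for m n
    using that
  proof (induction n rule: dec_induct)
    case (step n)
    have "norm (X (Suc n) - X m) \<le> norm (X (Suc n) - X n) + norm (X n - X m)"
      using norm_triangle_ineq[of "X (Suc n) - X n" "X n - X m"] by simp
    then show ?case using step X[of n] by simp
  qed simp
  have lt: "dist (X n) (X m) < e" if "m \<ge> N" "m \<le> n" for m n
    using tel[OF that(2)] N[OF that(1), of n] by (simp add: dist_norm)
  have "dist (X m) (X n) < e" if "m \<ge> N" "n \<ge> N" for m n
    using lt[of m n] lt[of n m] that by (cases m n rule: le_cases) (auto simp: dist_commute)
  then show "\<exists>M. \<forall>m\<ge>M. \<forall>n\<ge>M. dist (X m) (X n) < e" by blast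
qed

text \<open>One step of size \<open>h\<close> from \<open>X\<close> is compared with two steps of
  size \<open>h/2\<close> from \<open>y0\<close>. The only defect of monotonicity is that
  \<open>q1\<close> belongs to \<open>y1\<close> and not to \<open>y2\<close>, which costs a term of
  order \<open>h\<close> before the factor \<open>h\<close>. A local error of order
  \<open>h\<^sup>2\<close> in the squared distance sums to order \<open>h\<close> over
  \<open>T/h\<close> steps.\<close>

lemma (in maximal_monotone) step_halving_estimate:
  assumes h: "h > 0"
    and p: "p \<in> B X'" and q1: "q1 \<in> B y1" and q2: "q2 \<in> B y2"
    and X': "X' = X - h *\<^sub>R (p + \<omega> *\<^sub>R X)"
    and y1: "y1 = y0 - (h/2) *\<^sub>R (q1 + \<omega> *\<^sub>R y0)"
    and y2: "y2 = y1 - (h/2) *\<^sub>R (q2 + \<omega> *\<^sub>R y1)"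
    and bp: "norm p \<le> P" "norm q1 \<le> P"
    and bX: "norm (X' - X) \<le> M * h" and by1: "norm (y1 - y0) \<le> M * (h/2)"
    and by2: "norm (y2 - y1) \<le> M * (h/2)"
  shows "(norm (X' - y2))\<^sup>2 \<le> (1 + 3 * h * \<bar>\<omega>\<bar>) * (norm (X - y0))\<^sup>2
    + h\<^sup>2 * (P * M + 7 * h * \<bar>\<omega>\<bar> * M\<^sup>2)"
proof -
  define d' where "d' = X' - y2"
  define D where "D = norm (X - y0)"
  define a where "a = M * h"
  have a0: "a \<ge> 0" using norm_ge_zero[of "X' - X"] bX unfolding a_def by linarith
  have P0: "P \<ge> 0" using norm_ge_zero[of p] bp by linarith
  have D0: "D \<ge> 0" by (simp add: D_def)
  \<comment> \<open>The full step is split into two halves, so that \<open>p\<close> is paired once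
    with \<open>q1\<close> and once with \<open>q2\<close>.\<close>
  have diff: "d' - (X - y0) = - (h/2) *\<^sub>R ((p - q1) + (p - q2)) - (h * \<omega> / 2) *\<^sub>R ((X - y0) + (X - y1))"
  proof -
    have "d' - (X - y0) = (X' - X) - (y1 - y0) - (y2 - y1)" by (simp add: d'_def)
    also have "X' - X = - (h/2) *\<^sub>R p - (h/2) *\<^sub>R p - (h * \<omega> / 2) *\<^sub>R X - (h * \<omega> / 2) *\<^sub>R X"
      by (simp add: X' scaleR_add_right flip: scaleR_minus_left scaleR_add_left scaleR_diff_left)
    also have "y1 - y0 = - (h/2) *\<^sub>R q1 - (h * \<omega> / 2) *\<^sub>R y0"
      by (simp add: y1 scaleR_add_right)
    also have "y2 - y1 = - (h/2) *\<^sub>R q2 - (h * \<omega> / 2) *\<^sub>R y1"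
      by (simp add: y2 scaleR_add_right)
    finally show ?thesis by (simp add: scaleR_add_right scaleR_diff_right)
  qed
  have nd': "norm d' \<le> D + 2 * a"
  proof -
    have "d' = (X - y0) + ((X' - X) - (y1 - y0) - (y2 - y1))" by (simp add: d'_def)
    then have "norm d' \<le> D + norm ((X' - X) - (y1 - y0) - (y2 - y1))"
      unfolding D_def by (metis norm_triangle_ineq)
    moreover have "norm ((X' - X) - (y1 - y0) - (y2 - y1)) \<le> norm (X' - X) + norm (y1 - y0) + norm (y2 - y1)"
      by (meson add_right_mono norm_triangle_ineq4 order_trans)
    ultimately show ?thesis using bX by1 by2 unfolding a_def by argo
  qed
  have nXy1: "norm (X - y1) \<le> D + a / 2"
  proof -
    have "norm (X - y1) \<le> norm (X - y0) + norm (y1 - y0)"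
      using norm_triangle_ineq4[of "X - y0" "y1 - y0"] by simp
    then show ?thesis using by1 by (simp add: D_def a_def)
  qed
  have m2: "0 \<le> (p - q2) \<bullet> d'" unfolding d'_def by (rule mono[OF p q2])
  have m1: "- (P * a) \<le> (p - q1) \<bullet> d'"
  proof -
    have "(p - q1) \<bullet> d' = (p - q1) \<bullet> (X' - y1) - (p - q1) \<bullet> (y2 - y1)"
      by (simp add: d'_def inner_diff_right)
    moreover have "0 \<le> (p - q1) \<bullet> (X' - y1)" by (rule mono[OF p q1])
    moreover have "(p - q1) \<bullet> (y2 - y1) \<le> P * a"
    proof -
      have "norm (p - q1) \<le> 2 * P" using norm_triangle_ineq4[of p q1] bp by linarith
      then have "norm (p - q1) * norm (y2 - y1) \<le> (2 * P) * (M * (h/2))"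
        using by2 P0 by (intro mult_mono) auto
      then show ?thesis using norm_cauchy_schwarz[of "p - q1" "y2 - y1"] by (simp add: a_def)
    qed
    ultimately show ?thesis by linarith
  qed
  have m3: "- (\<omega> * (((X - y0) + (X - y1)) \<bullet> d')) \<le> \<bar>\<omega>\<bar> * (3 * D\<^sup>2 + 7 * a\<^sup>2)"
  proof -
    have "\<bar>((X - y0) + (X - y1)) \<bullet> d'\<bar> \<le> norm ((X - y0) + (X - y1)) * norm d'"
      by (rule Cauchy_Schwarz_ineq2)
    also have "\<dots> \<le> (2 * D + a / 2) * (D + 2 * a)"
    proof (rule mult_mono)
      show "norm ((X - y0) + (X - y1)) \<le> 2 * D + a / 2"
        using norm_triangle_ineq[of "X - y0" "X - y1"] nXy1 unfolding D_def by linarith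
    qed (use nd' a0 D0 in auto)
    also have "\<dots> \<le> 3 * D\<^sup>2 + 7 * a\<^sup>2"
    proof -
      \<comment> \<open>\<open>9/4\<close> is half the cross coefficient \<open>9/2\<close> of the
        product being bounded.\<close>
      have "0 \<le> (D - 9/4 * a)\<^sup>2" by simp
      then have "9/2 * (D * a) \<le> D\<^sup>2 + 81/16 * a\<^sup>2" by (simp add: power2_eq_square algebra_simps)
      moreover have "81/16 * a\<^sup>2 \<le> 6 * a\<^sup>2" by simp
      moreover have "(2 * D + a / 2) * (D + 2 * a) = 2 * D\<^sup>2 + 9/2 * (D * a) + a\<^sup>2"
        by (simp add: power2_eq_square algebra_simps)
      ultimately show ?thesis by linarith
    qed
    finally have "\<bar>\<omega>\<bar> * \<bar>((X - y0) + (X - y1)) \<bullet> d'\<bar> \<le> \<bar>\<omega>\<bar> * (3 * D\<^sup>2 + 7 * a\<^sup>2)"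
      by (intro mult_left_mono) auto
    then show ?thesis using abs_ge_minus_self[of "\<omega> * (((X - y0) + (X - y1)) \<bullet> d')"]
      by (simp only: abs_mult)
  qed
  \<comment> \<open>Expanding around the new difference \<open>d'\<close> pairs the increment with
    the points at which the elements of \<open>B\<close> are taken, and the leftover square has the
    favourable sign.\<close>
  have "(norm d')\<^sup>2 = D\<^sup>2 + 2 * ((d' - (X - y0)) \<bullet> d') - (norm (d' - (X - y0)))\<^sup>2"
    unfolding D_def power2_norm_eq_inner by (simp add: inner_diff_left inner_diff_right inner_commute)
  also have "\<dots> \<le> D\<^sup>2 + 2 * ((d' - (X - y0)) \<bullet> d')" by simp
  also have "2 * ((d' - (X - y0)) \<bullet> d')
      = h * (- ((p - q1) \<bullet> d') - (p - q2) \<bullet> d' - \<omega> * (((X - y0) + (X - y1)) \<bullet> d'))"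
    unfolding diff by (simp add: inner_diff_left inner_add_left algebra_simps)
  also have "\<dots> \<le> h * (P * a + \<bar>\<omega>\<bar> * (3 * D\<^sup>2 + 7 * a\<^sup>2))"
    using m1 m2 m3 h by (intro mult_left_mono) linarith+
  also have "D\<^sup>2 + h * (P * a + \<bar>\<omega>\<bar> * (3 * D\<^sup>2 + 7 * a\<^sup>2))
      = (1 + 3 * h * \<bar>\<omega>\<bar>) * D\<^sup>2 + h\<^sup>2 * (P * M + 7 * h * \<bar>\<omega>\<bar> * M\<^sup>2)"
    by (simp add: a_def power2_eq_square algebra_simps)
  finally show ?thesis by (simp add: d'_def D_def)
qed

locale implicit_euler = maximal_monotone B
  for B :: "'a::{real_inner, complete_space} \<Rightarrow> 'a set" +
  fixes \<omega> :: real and x0 p0 :: 'a and T :: real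
  assumes p0: "p0 \<in> B x0" and T: "T > 0"
begin

definition resolvent :: "real \<Rightarrow> 'a \<Rightarrow> 'a" where
  "resolvent h z = (SOME x. \<exists>p\<in>B x. x + h *\<^sub>R p = z)"

primrec euler :: "real \<Rightarrow> nat \<Rightarrow> 'a" where
  "euler h 0 = x0"
| "euler h (Suc n) = resolvent h ((1 - h * \<omega>) *\<^sub>R euler h n)"

text \<open>The scheme solved for the element of \<open>B\<close>. It belongs to the new point
  \<open>euler h (Suc n)\<close>, whereas the \<open>\<omega>\<close> term is evaluated at the old
  one.\<close>

definition slope :: "real \<Rightarrow> nat \<Rightarrow> 'a" where
  "slope h n = (1/h) *\<^sub>R (euler h n - euler h (Suc n)) - \<omega> *\<^sub>R euler h n"

lemma slope_step:
  assumes "h > 0"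
  shows "euler h (Suc n) + h *\<^sub>R slope h n = (1 - h * \<omega>) *\<^sub>R euler h n"
    and "euler h (Suc n) = euler h n - h *\<^sub>R (slope h n + \<omega> *\<^sub>R euler h n)"
  using assms by (simp_all add: slope_def algebra_simps del: euler.simps)

lemma slope_in: 
  assumes h: "h > 0"
  shows "slope h n \<in> B (euler h (Suc n))"
proof -
  have "\<exists>p\<in>B (euler h (Suc n)). euler h (Suc n) + h *\<^sub>R p = (1 - h * \<omega>) *\<^sub>R euler h n"
    unfolding euler.simps resolvent_def by (rule someI_ex) (rule range[OF h])
  then obtain p where p: "p \<in> B (euler h (Suc n))"
    and eq: "euler h (Suc n) + h *\<^sub>R p = (1 - h * \<omega>) *\<^sub>R euler h n" by blast
  have "h *\<^sub>R p = h *\<^sub>R slope h n" using eq slope_step(1)[OF h, of n] by (metis add_left_cancel)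
  then show ?thesis using p h by simp
qed

abbreviation "L \<equiv> \<bar>\<omega>\<bar>"
abbreviation "V0 \<equiv> norm (p0 + \<omega> *\<^sub>R x0)"
text \<open>\<open>M\<close> is the first-step speed \<open>V0\<close> carried through the growth
  factor, \<open>R\<close> bounds the Euler points, and \<open>K\<close> is the local constant of
  \<open>step_halving_estimate\<close> with \<open>P = M + L * R\<close> and
  \<open>h \<le> 1\<close>. The horizon is \<open>T + 1\<close> because sums of rounded indices in
  \<open>trajectory_translate\<close> may overshoot \<open>T\<close> by less than one step.\<close>

definition "M = exp (L * (T + 1)) * V0"
definition "R = norm x0 + M * (T + 1)"
definition "K = (M + L * R) * M + 7 * L * M\<^sup>2"

lemma constants_nonneg: "M \<ge> 0" "R \<ge> 0" "K \<ge> 0"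
proof -
  show M: "M \<ge> 0" by (simp add: M_def)
  show R: "R \<ge> 0" using M T by (simp add: R_def)
  show "K \<ge> 0" using M R by (simp add: K_def)
qed

lemma growth_factor: 
  assumes "h > 0" "c \<ge> 0" "real n * h \<le> t"
  shows "(1 + h * c) ^ n \<le> exp (c * t)"
proof -
  have "(1 + h * c) ^ n \<le> exp (h * c) ^ n"
    using assms by (intro power_mono) (auto simp: exp_ge_add_one_self)
  also have "\<dots> = exp (c * (n * h))" by (simp add: exp_of_nat_mult[symmetric] mult_ac)
  also have "\<dots> \<le> exp (c * t)" using assms by (simp add: mult_left_mono)
  finally show ?thesis .
qed

lemma factor_norm:
  assumes "h > 0"
  shows "norm ((1 - h * \<omega>) *\<^sub>R z) \<le> (1 + h * L) * norm z"
proof -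
  have "\<bar>1 - h * \<omega>\<bar> \<le> 1 + h * L" using assms abs_triangle_ineq4[of 1 "h * \<omega>"] by (simp add: abs_mult)
  then show ?thesis by (simp add: mult_right_mono)
qed

text \<open>Each step is an affine expansion by at most \<open>1 + h * L\<close> followed by a
  nonexpansive resolvent. Consecutive indices give the speed bound; indices a fixed time apart
  compare translates of the arc.\<close>

lemma euler_contraction:
  assumes h: "h > 0"
  shows "norm (euler h (i + n) - euler h (j + n)) \<le> (1 + h * L) ^ n * norm (euler h i - euler h j)"
proof (induction n)
  case (Suc n)
  have "norm (euler h (Suc (i + n)) - euler h (Suc (j + n)))
     \<le> norm ((1 - h * \<omega>) *\<^sub>R euler h (i + n) - (1 - h * \<omega>) *\<^sub>R euler h (j + n))"
    using resolvent_nonexpansive[OF slope_in[OF h, of "i + n"] slope_in[OF h, of "j + n"], of h] h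
    by (simp only: slope_step(1)[OF h])
  also have "\<dots> \<le> (1 + h * L) * norm (euler h (i + n) - euler h (j + n))"
    using factor_norm[OF h] by (simp flip: scaleR_diff_right)
  also have "\<dots> \<le> (1 + h * L) * ((1 + h * L) ^ n * norm (euler h i - euler h j))"
    using Suc h by (intro mult_left_mono) auto
  finally show ?case by (simp add: mult.assoc)
qed simp

text \<open>The point \<open>x\<close> is itself the resolvent of \<open>x + h *\<^sub>R p\<close>,
  so it can be compared with the scheme as a constant sequence with residual
  \<open>p + \<omega> *\<^sub>R x\<close>. Taken at a point of the limit arc, this controls the
  right difference quotients.\<close>

lemma euler_dist_point:
  assumes h: "h > 0" and p: "p \<in> B x"
  shows "norm (euler h (m + n) - x)
    \<le> (1 + h * L) ^ n * (norm (euler h m - x) + n * h * norm (p + \<omega> *\<^sub>R x))"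
proof (induction n)
  case (Suc n)
  let ?c = "norm (p + \<omega> *\<^sub>R x)"
  have "norm (euler h (Suc (m + n)) - x) \<le> norm ((1 - h * \<omega>) *\<^sub>R euler h (m + n) - (x + h *\<^sub>R p))"
    using resolvent_nonexpansive[OF slope_in[OF h, of "m + n"] p, of h] h
    by (simp only: slope_step(1)[OF h])
  also have "(1 - h * \<omega>) *\<^sub>R euler h (m + n) - (x + h *\<^sub>R p)
    = (1 - h * \<omega>) *\<^sub>R (euler h (m + n) - x) - h *\<^sub>R (p + \<omega> *\<^sub>R x)"
    by (simp add: algebra_simps)
  also have "norm \<dots> \<le> norm ((1 - h * \<omega>) *\<^sub>R (euler h (m + n) - x)) + norm (h *\<^sub>R (p + \<omega> *\<^sub>R x))"
    by (rule norm_triangle_ineq4)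
  also have "\<dots> \<le> (1 + h * L) * norm (euler h (m + n) - x) + h * ?c"
    using factor_norm[OF h, of "euler h (m + n) - x"] h by simp
  also have "\<dots> \<le> (1 + h * L) * ((1 + h * L) ^ n * (norm (euler h m - x) + n * h * ?c))
      + (1 + h * L) ^ Suc n * (h * ?c)"
  proof (rule add_mono)
    show "(1 + h * L) * norm (euler h (m + n) - x)
      \<le> (1 + h * L) * ((1 + h * L) ^ n * (norm (euler h m - x) + n * h * ?c))"
      using Suc h by (intro mult_left_mono) auto
    have "1 \<le> (1 + h * L) ^ Suc n" using h by (intro one_le_power) simp
    then show "h * ?c \<le> (1 + h * L) ^ Suc n * (h * ?c)"
      using mult_right_mono[of 1 "(1 + h * L) ^ Suc n" "h * ?c"] h by simp
  qed
  also have "\<dots> = (1 + h * L) ^ Suc n * (norm (euler h m - x) + Suc n * h * ?c)"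
    by (simp add: algebra_simps)
  finally show ?case by simp
qed simp

text \<open>Here \<open>p0 \<in> B x0\<close> is decisive: it bounds the first step by
  \<open>h * V0\<close>, and contraction propagates that bound.\<close>

lemma euler_increment:
  assumes h: "h > 0" and n: "real n * h \<le> T + 1"
  shows "norm (euler h (Suc n) - euler h n) \<le> M * h"
proof -
  have "norm (euler h (Suc n) - euler h n) \<le> (1 + h * L) ^ n * norm (euler h 1 - euler h 0)"
    using euler_contraction[OF h, of 1 n 0] by simp
  also have "\<dots> \<le> (1 + h * L) ^ n * ((1 + h * L) * 0 + h * V0)"
  proof (rule mult_left_mono)
    have "norm (euler h (Suc 0) - x0) \<le> norm ((1 - h * \<omega>) *\<^sub>R x0 - (x0 + h *\<^sub>R p0))"
      using resolvent_nonexpansive[OF slope_in[OF h, of 0] p0, of h] h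
      by (simp only: slope_step(1)[OF h]) simp
    also have "(1 - h * \<omega>) *\<^sub>R x0 - (x0 + h *\<^sub>R p0) = - (h *\<^sub>R (p0 + \<omega> *\<^sub>R x0))"
      by (simp add: algebra_simps)
    finally show "norm (euler h 1 - euler h 0) \<le> (1 + h * L) * 0 + h * V0" using h by simp
  qed (use h in simp)
  also have "\<dots> \<le> exp (L * (T + 1)) * (h * V0)"
    using growth_factor[OF h, of L n "T + 1"] n h by (simp add: mult_right_mono)
  finally show ?thesis by (simp add: M_def mult_ac)
qed

lemma euler_lipschitz:
  assumes h: "h > 0" and i: "real i * h \<le> T + 1" and j: "real j * h \<le> T + 1"
  shows "norm (euler h i - euler h j) \<le> M * (h * \<bar>real i - real j\<bar>)"
proof -
  have *: "norm (euler h i - euler h j) \<le> M * (h * (real i - real j))"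
    if "j \<le> i" "real i * h \<le> T + 1" for i j
    using that
  proof (induction i rule: dec_induct)
    case (step n)
    have n: "real n * h \<le> T + 1"
      using step.prems h by (smt (verit) mult_right_mono of_nat_Suc)
    have "norm (euler h (Suc n) - euler h j)
        \<le> norm (euler h (Suc n) - euler h n) + norm (euler h n - euler h j)"
      using norm_triangle_ineq[of "euler h (Suc n) - euler h n" "euler h n - euler h j"]
      by (simp del: euler.simps)
    also have "\<dots> \<le> M * h + M * (h * (real n - real j))"
      using euler_increment[OF h n] step.IH[OF n] by linarith
    finally show ?case by (simp add: algebra_simps del: euler.simps)
  qed simp
  show ?thesis
  proof (cases "j \<le> i")
    case True
    then show ?thesis using *[OF True i] by simp
  next
    case False
    then show ?thesis using *[of i j] j by (simp add: norm_minus_commute)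
  qed
qed

lemma euler_norm:
  assumes h: "h > 0" and n: "real n * h \<le> T + 1"
  shows "norm (euler h n) \<le> R"
proof -
  have "norm (euler h n) \<le> norm (euler h 0) + norm (euler h n - euler h 0)"
    by (metis norm_triangle_sub)
  also have "norm (euler h n - euler h 0) \<le> M * (h * n)"
    using euler_lipschitz[OF h n, of 0] T by simp
  also have "\<dots> \<le> M * (T + 1)"
    using n constants_nonneg by (intro mult_left_mono) (auto simp: mult.commute)
  finally show ?thesis by (simp add: R_def)
qed

lemma slope_norm:
  assumes h: "h > 0" and n: "real n * h \<le> T + 1"
  shows "norm (slope h n) \<le> M + L * R"
proof -
  have "norm (slope h n) \<le> norm ((1/h) *\<^sub>R (euler h n - euler h (Suc n))) + norm (\<omega> *\<^sub>R euler h n)"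
    unfolding slope_def by (rule norm_triangle_ineq4)
  moreover have "norm ((1/h) *\<^sub>R (euler h n - euler h (Suc n))) \<le> M"
    using euler_increment[OF h n] h
    by (simp add: norm_minus_commute pos_divide_le_eq del: euler.simps scaleR_diff_right)
  moreover have "norm (\<omega> *\<^sub>R euler h n) \<le> L * R"
    using euler_norm[OF h n] by (simp add: mult_left_mono)
  ultimately show ?thesis by linarith
qed

text \<open>Discrete Gronwall for the local estimate. As \<open>n * h\<close> is bounded, the right
  side is of order \<open>h\<close>.\<close>

lemma euler_halving:
  assumes h: "h > 0" "h \<le> 1" and n: "real n * h \<le> T + 1"
  shows "(norm (euler h n - euler (h/2) (2 * n)))\<^sup>2 \<le> (1 + h * (3 * L)) ^ n * (n * (h\<^sup>2 * K))"
  using n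
proof (induction n)
  case (Suc n)
  have h2: "h/2 > 0" using h by simp
  have n: "real n * h \<le> T + 1" using Suc.prems h by (simp add: algebra_simps)
  have n2: "real (2 * n) * (h/2) \<le> T + 1" "real (Suc (2 * n)) * (h/2) \<le> T + 1"
    using Suc.prems h by (auto simp: algebra_simps)
  let ?r = "1 + h * (3 * L)"
  have r: "1 \<le> ?r ^ Suc n" using h by (intro one_le_power) simp
  have "(norm (euler h (Suc n) - euler (h/2) (Suc (Suc (2 * n)))))\<^sup>2
    \<le> (1 + 3 * h * L) * (norm (euler h n - euler (h/2) (2 * n)))\<^sup>2
      + h\<^sup>2 * ((M + L * R) * M + 7 * h * L * M\<^sup>2)"
    by (rule step_halving_estimate[OF h(1) slope_in[OF h(1)] slope_in[OF h2] slope_in[OF h2]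
          slope_step(2)[OF h(1)] slope_step(2)[OF h2] slope_step(2)[OF h2]
          slope_norm[OF h(1) n] slope_norm[OF h2 n2(1)]
          euler_increment[OF h(1) n] euler_increment[OF h2 n2(1)] euler_increment[OF h2 n2(2)]])
  also have "\<dots> \<le> ?r * (?r ^ n * (n * (h\<^sup>2 * K))) + ?r ^ Suc n * (h\<^sup>2 * K)"
  proof (rule add_mono)
    show "(1 + 3 * h * L) * (norm (euler h n - euler (h/2) (2 * n)))\<^sup>2 \<le> ?r * (?r ^ n * (n * (h\<^sup>2 * K)))"
      using Suc.IH[OF n] h by (intro mult_mono) auto
    have "7 * h * L * M\<^sup>2 \<le> 7 * L * M\<^sup>2"
      using h by (intro mult_right_mono) (auto simp: mult_left_le_one_le)
    then have "h\<^sup>2 * ((M + L * R) * M + 7 * h * L * M\<^sup>2) \<le> h\<^sup>2 * K"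
      unfolding K_def by (intro mult_left_mono) auto
    also have "\<dots> \<le> ?r ^ Suc n * (h\<^sup>2 * K)"
      using mult_right_mono[OF r, of "h\<^sup>2 * K"] constants_nonneg by simp
    finally show "h\<^sup>2 * ((M + L * R) * M + 7 * h * L * M\<^sup>2) \<le> ?r ^ Suc n * (h\<^sup>2 * K)" .
  qed
  finally show ?case by (simp add: algebra_simps del: euler.simps)
qed simp

text \<open>A discrete integral-solution inequality: no slope of the scheme occurs in it, so it
  survives the limit without any derivative. All data are frozen at the starting point
  \<open>euler h m\<close>, with an error quadratic in the elapsed time.\<close>

lemma euler_energy:
  assumes h: "h > 0" and p: "p \<in> B x" and mn: "real (m + n) * h \<le> T + 1"
  shows "(norm (euler h (m + n) - x))\<^sup>2 - (norm (euler h m - x))\<^sup>2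
    \<le> 2 * (n * h) * ((p + \<omega> *\<^sub>R euler h m) \<bullet> (x - euler h m))
      + 2 * M * (norm p + 2 * L * R + L * norm x) * (n * h)\<^sup>2"
  (is "_ \<le> 2 * (n * h) * ?a + 2 * M * ?Q * _")
proof -
  have one: "(norm (euler h (Suc (m + i)) - x))\<^sup>2 - (norm (euler h (m + i) - x))\<^sup>2
      \<le> 2 * h * ?a + 2 * h * (M * (h * n) * ?Q)" if i: "i < n" for i
  proof -
    define e e' em where "e = euler h (m + i)" and "e' = euler h (Suc (m + i))" and "em = euler h m"
    define s where "s = slope h (m + i)"
    have b: "real (m + i) * h \<le> T + 1" "real (Suc (m + i)) * h \<le> T + 1" "real m * h \<le> T + 1"
    proof -
      have *: "real k * h \<le> T + 1" if "k \<le> m + n" for k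
        using mn that h by (smt (verit) mult_right_mono of_nat_le_iff)
      then show "real (m + i) * h \<le> T + 1" "real (Suc (m + i)) * h \<le> T + 1" "real m * h \<le> T + 1"
        using *[of "m + i"] *[of "Suc (m + i)"] *[of m] i by auto
    qed
    have Mn: "0 \<le> M * (h * n)" using constants_nonneg h by simp
    have d1: "norm (e' - em) \<le> M * (h * n)"
    proof -
      have "norm (e' - em) \<le> M * (h * \<bar>real (Suc (m + i)) - real m\<bar>)"
        unfolding e'_def em_def by (rule euler_lipschitz[OF h b(2,3)])
      also have "\<dots> \<le> M * (h * n)" using i constants_nonneg h by (intro mult_left_mono) auto
      finally show ?thesis .
    qed
    have d2: "norm (e - em) \<le> M * (h * n)"
    proof -
      have "norm (e - em) \<le> M * (h * \<bar>real (m + i) - real m\<bar>)"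
        unfolding e_def em_def by (rule euler_lipschitz[OF h b(1,3)])
      also have "\<dots> \<le> M * (h * n)" using i constants_nonneg h by (intro mult_left_mono) auto
      finally show ?thesis .
    qed
    have ne: "norm e \<le> R" "norm em \<le> R"
      unfolding e_def em_def by (rule euler_norm[OF h b(1)] euler_norm[OF h b(3)])+
    have step: "e' = e - h *\<^sub>R (s + \<omega> *\<^sub>R e)"
      unfolding e_def e'_def s_def by (rule slope_step(2)[OF h])
    have "(norm (e' - x))\<^sup>2 - (norm (e - x))\<^sup>2 = 2 * ((e' - e) \<bullet> (e' - x)) - (norm (e' - e))\<^sup>2"
      unfolding power2_norm_eq_inner by (simp add: inner_diff_left inner_diff_right inner_commute)
    also have "\<dots> \<le> 2 * ((e' - e) \<bullet> (e' - x))" by simp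
    also have "(e' - e) \<bullet> (e' - x) = - h * ((s + \<omega> *\<^sub>R e) \<bullet> (e' - x))" by (simp add: step)
    \<comment> \<open>Monotonicity discards the first summand; the second and third replace
      \<open>e'\<close> and \<open>e\<close> by \<open>em\<close>, which the Lipschitz bound prices
      at \<open>M * (h * n)\<close>.\<close>
    also have "(s + \<omega> *\<^sub>R e) \<bullet> (e' - x) = (s - p) \<bullet> (e' - x) + (p + \<omega> *\<^sub>R e) \<bullet> (e' - em)
        + \<omega> * ((e - em) \<bullet> (em - x)) - (p + \<omega> *\<^sub>R em) \<bullet> (x - em)"
      by (simp add: inner_diff_left inner_diff_right inner_add_left algebra_simps)
    finally have eq: "(norm (e' - x))\<^sup>2 - (norm (e - x))\<^sup>2 \<le> 2 * (- h * ((s - p) \<bullet> (e' - x)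
        + (p + \<omega> *\<^sub>R e) \<bullet> (e' - em) + \<omega> * ((e - em) \<bullet> (em - x)) - (p + \<omega> *\<^sub>R em) \<bullet> (x - em)))" .
    have t1: "0 \<le> (s - p) \<bullet> (e' - x)"
      unfolding e'_def s_def by (rule mono[OF slope_in[OF h] p])
    have t2: "- (M * (h * n) * (norm p + L * R)) \<le> (p + \<omega> *\<^sub>R e) \<bullet> (e' - em)"
    proof -
      have "\<bar>(p + \<omega> *\<^sub>R e) \<bullet> (e' - em)\<bar> \<le> norm (p + \<omega> *\<^sub>R e) * norm (e' - em)"
        by (rule Cauchy_Schwarz_ineq2)
      also have "\<dots> \<le> (norm p + L * R) * (M * (h * n))"
      proof (rule mult_mono)
        have "L * norm e \<le> L * R" using ne by (intro mult_left_mono) auto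
        then show "norm (p + \<omega> *\<^sub>R e) \<le> norm p + L * R"
          using norm_triangle_ineq[of p "\<omega> *\<^sub>R e"] by simp
      qed (use d1 constants_nonneg in auto)
      finally show ?thesis by (simp add: mult.commute abs_le_iff)
    qed
    have t3: "- (M * (h * n) * (L * R + L * norm x)) \<le> \<omega> * ((e - em) \<bullet> (em - x))"
    proof -
      have "\<bar>\<omega> * ((e - em) \<bullet> (em - x))\<bar> \<le> L * (norm (e - em) * norm (em - x))"
        unfolding abs_mult by (intro mult_left_mono Cauchy_Schwarz_ineq2) auto
      also have "\<dots> \<le> L * ((M * (h * n)) * (R + norm x))"
        using d2 ne(2) norm_triangle_ineq4[of em x] Mn
        by (intro mult_left_mono mult_mono) auto
      also have "\<dots> = M * (h * n) * (L * R + L * norm x)" by (simp add: algebra_simps)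
      finally show ?thesis by linarith
    qed
    have "- (M * (h * n) * ?Q) - ?a \<le> (s - p) \<bullet> (e' - x)
        + (p + \<omega> *\<^sub>R e) \<bullet> (e' - em) + \<omega> * ((e - em) \<bullet> (em - x)) - (p + \<omega> *\<^sub>R em) \<bullet> (x - em)"
      using t1 t2 t3 by (simp add: em_def algebra_simps)
    then have "h * (- (M * (h * n) * ?Q) - ?a) \<le> h * ((s - p) \<bullet> (e' - x)
        + (p + \<omega> *\<^sub>R e) \<bullet> (e' - em) + \<omega> * ((e - em) \<bullet> (em - x)) - (p + \<omega> *\<^sub>R em) \<bullet> (x - em))"
      using h by (intro mult_left_mono) auto
    with eq have "(norm (e' - x))\<^sup>2 - (norm (e - x))\<^sup>2 \<le> 2 * (- (h * (- (M * (h * n) * ?Q) - ?a)))"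
      by linarith
    also have "\<dots> = 2 * h * ?a + 2 * h * (M * (h * n) * ?Q)"
    proof -
      have "2 * - (h * (- X - a)) = 2 * h * a + 2 * h * X" for X a :: real by (simp add: algebra_simps)
      then show ?thesis .
    qed
    finally show ?thesis by (simp only: e_def e'_def)
  qed
  have "(norm (euler h (m + i) - x))\<^sup>2 - (norm (euler h m - x))\<^sup>2
      \<le> i * (2 * h * ?a + 2 * h * (M * (h * n) * ?Q))" if "i \<le> n" for i
    using that
  proof (induction i)
    case (Suc i)
    have "(norm (euler h (m + Suc i) - x))\<^sup>2 - (norm (euler h m - x))\<^sup>2
      \<le> (2 * h * ?a + 2 * h * (M * (h * n) * ?Q)) + i * (2 * h * ?a + 2 * h * (M * (h * n) * ?Q))"
      using one[of i] Suc by (simp del: euler.simps)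
    also have "\<dots> = Suc i * (2 * h * ?a + 2 * h * (M * (h * n) * ?Q))" by (simp add: distrib_right)
    finally show ?case .
  qed simp
  from this[of n] show ?thesis by (simp add: algebra_simps power2_eq_square)
qed

end

section \<open>Convergence along the dyadic step sizes\<close>

context implicit_euler
begin

definition grid_index :: "nat \<Rightarrow> real \<Rightarrow> nat" where
  "grid_index k t = nat \<lfloor>t * 2 ^ k\<rfloor>"

definition approximant :: "nat \<Rightarrow> real \<Rightarrow> 'a" where
  "approximant k t = euler ((1/2) ^ k) (grid_index k t)"

definition trajectory :: "real \<Rightarrow> 'a" where
  "trajectory t = lim (\<lambda>k. approximant k t)"

lemma grid_index_bounds:
  assumes "t \<ge> 0"
  shows "real (grid_index k t) * (1/2) ^ k \<le> t"
    and "t - (1/2) ^ k < real (grid_index k t) * (1/2) ^ k"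
proof -
  have r: "real (grid_index k t) = of_int \<lfloor>t * 2 ^ k\<rfloor>" using assms by (simp add: grid_index_def)
  have "of_int \<lfloor>t * 2 ^ k\<rfloor> * (1/2) ^ k \<le> (t * 2 ^ k) * (1/2) ^ k"
    by (intro mult_right_mono) auto
  then show "real (grid_index k t) * (1/2) ^ k \<le> t" by (simp add: r field_simps)
  have "(t * 2 ^ k - 1) * (1/2) ^ k < of_int \<lfloor>t * 2 ^ k\<rfloor> * (1/2) ^ k"
    by (intro mult_strict_right_mono) (linarith, simp)
  then show "t - (1/2) ^ k < real (grid_index k t) * (1/2) ^ k"
    by (simp add: r field_simps)
qed

lemma grid_index_mono: "s \<le> t \<Longrightarrow> grid_index k s \<le> grid_index k t"
  unfolding grid_index_def by (intro nat_mono floor_mono mult_right_mono) auto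

lemma grid_time_tendsto:
  assumes "t \<ge> 0"
  shows "(\<lambda>k. real (grid_index k t) * (1/2) ^ k) \<longlonglongrightarrow> t"
proof (rule tendsto_sandwich)
  show "(\<lambda>k. t - (1/2) ^ k) \<longlonglongrightarrow> t"
    using tendsto_diff[OF tendsto_const[of t] LIMSEQ_power_zero[of "1/2 :: real"]] by simp
  show "\<forall>\<^sub>F k in sequentially. t - (1/2) ^ k \<le> real (grid_index k t) * (1/2) ^ k"
    using grid_index_bounds(2)[OF assms] by (simp add: less_imp_le)
qed (use grid_index_bounds(1)[OF assms] in auto)

lemma grid_index_Suc:
  assumes "t \<ge> 0"
  shows "grid_index (Suc k) t = 2 * grid_index k t \<or> grid_index (Suc k) t = Suc (2 * grid_index k t)"
proof -
  have "\<lfloor>t * 2 ^ Suc k\<rfloor> = 2 * \<lfloor>t * 2 ^ k\<rfloor> \<or> \<lfloor>t * 2 ^ Suc k\<rfloor> = 2 * \<lfloor>t * 2 ^ k\<rfloor> + 1"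
  proof -
    define r where "r = t * 2 ^ k"
    have "\<lfloor>2 * r\<rfloor> = 2 * \<lfloor>r\<rfloor> \<or> \<lfloor>2 * r\<rfloor> = 2 * \<lfloor>r\<rfloor> + 1" by linarith
    moreover have "t * 2 ^ Suc k = 2 * r" by (simp add: r_def)
    ultimately show ?thesis by (simp only: r_def)
  qed
  moreover have "0 \<le> \<lfloor>t * 2 ^ k\<rfloor>" using assms by simp
  ultimately show ?thesis unfolding grid_index_def by linarith
qed

lemma grid_index_time:
  assumes "0 \<le> t" "t \<le> T"
  shows "real (grid_index k t) * (1/2) ^ k \<le> T + 1"
  using grid_index_bounds(1)[OF assms(1), of k] assms(2) by linarith

text \<open>Passing from level \<open>k\<close> to \<open>k + 1\<close> costs the halving error, a
  multiple of \<open>sqrt (1/2) ^ k\<close>, and one more half step if \<open>t\<close> lies in the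
  right half of its cell. Both bounds are geometric.\<close>

lemma approximant_tendsto:
  assumes t: "0 \<le> t" "t \<le> T"
  shows "(\<lambda>k. approximant k t) \<longlonglongrightarrow> trajectory t"
proof -
  define C where "C = sqrt (exp (3 * L * (T + 1)) * ((T + 1) * K))"
  have "norm (approximant (Suc k) t - approximant k t) \<le> C * sqrt (1/2) ^ k + M * (1/2) ^ k" for k
  proof -
    define h where "h = (1/2 :: real) ^ k"
    define n where "n = grid_index k t"
    have h: "h > 0" "h \<le> 1" by (auto simp: h_def power_le_one)
    have n: "real n * h \<le> T + 1" unfolding n_def h_def by (rule grid_index_time[OF t])
    have h2: "h/2 > 0" using h by simp
    have hS: "(1/2) ^ Suc k = h/2" by (simp add: h_def)
    have bS: "real (grid_index (Suc k) t) * (h/2) \<le> T + 1"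
      using grid_index_time[OF t, of "Suc k"] by (simp only: hS)
    have "(norm (euler h n - euler (h/2) (2 * n)))\<^sup>2 \<le> (1 + h * (3 * L)) ^ n * (n * (h\<^sup>2 * K))"
      by (rule euler_halving[OF h n])
    also have "\<dots> \<le> exp (3 * L * (T + 1)) * (((T + 1) * K) * h)"
    proof (rule mult_mono)
      show "(1 + h * (3 * L)) ^ n \<le> exp (3 * L * (T + 1))"
        by (rule growth_factor[OF h(1) _ n]) simp
      have "real n * h * (h * K) \<le> (T + 1) * (h * K)"
        using n h constants_nonneg by (intro mult_right_mono) auto
      then show "real n * (h\<^sup>2 * K) \<le> (T + 1) * K * h" by (simp add: power2_eq_square algebra_simps)
    qed (use h constants_nonneg in auto)
    finally have "norm (euler h n - euler (h/2) (2 * n)) \<le> sqrt (exp (3 * L * (T + 1)) * ((T + 1) * K * h))"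
      by (rule real_le_rsqrt)
    also have "\<dots> = C * sqrt (1/2) ^ k"
      by (simp add: C_def h_def real_sqrt_mult real_sqrt_power)
    finally have a: "norm (euler (h/2) (2 * n) - euler h n) \<le> C * sqrt (1/2) ^ k"
      by (simp add: norm_minus_commute)
    have b: "norm (approximant (Suc k) t - euler (h/2) (2 * n)) \<le> M * h"
    proof -
      have "norm (euler (h/2) (grid_index (Suc k) t) - euler (h/2) (2 * n))
        \<le> M * (h/2 * \<bar>real (grid_index (Suc k) t) - real (2 * n)\<bar>)"
        by (rule euler_lipschitz[OF h2 bS]) (use n in simp)
      also have "\<dots> \<le> M * (h * 1)"
      proof (intro mult_left_mono mult_mono)
        show "\<bar>real (grid_index (Suc k) t) - real (2 * n)\<bar> \<le> 1"
          using grid_index_Suc[OF t(1), of k] unfolding n_def by auto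
      qed (use h constants_nonneg in auto)
      finally show ?thesis by (simp only: approximant_def hS mult_1_right)
    qed
    have "norm (approximant (Suc k) t - approximant k t)
      \<le> norm (approximant (Suc k) t - euler (h/2) (2 * n)) + norm (euler (h/2) (2 * n) - euler h n)"
      using norm_triangle_ineq[of "approximant (Suc k) t - euler (h/2) (2 * n)" "euler (h/2) (2 * n) - euler h n"]
      by (simp add: approximant_def h_def n_def)
    then show ?thesis using a b unfolding h_def by linarith
  qed
  moreover have "summable (\<lambda>k. C * sqrt (1/2) ^ k + M * (1/2) ^ k)"
    by (intro summable_add summable_mult summable_geometric) auto
  ultimately have "Cauchy (\<lambda>k. approximant k t)" by (rule Cauchy_if_summable_increments)
  then show ?thesis
    unfolding trajectory_def using Cauchy_convergent_iff convergent_LIMSEQ_iff by blast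
qed

lemma trajectory_0: "trajectory 0 = x0"
proof -
  have "(\<lambda>k. approximant k 0) \<longlonglongrightarrow> trajectory 0" using T by (intro approximant_tendsto) auto
  then show ?thesis by (simp add: approximant_def grid_index_def LIMSEQ_const_iff)
qed

lemma trajectory_lipschitz:
  assumes s: "0 \<le> s" "s \<le> T" and t: "0 \<le> t" "t \<le> T"
  shows "norm (trajectory t - trajectory s) \<le> M * \<bar>t - s\<bar>"
proof (rule LIMSEQ_le)
  show "(\<lambda>k. norm (approximant k t - approximant k s)) \<longlonglongrightarrow> norm (trajectory t - trajectory s)"
    by (intro tendsto_intros approximant_tendsto s t)
  show "(\<lambda>k. M * \<bar>real (grid_index k t) * (1/2) ^ k - real (grid_index k s) * (1/2) ^ k\<bar>) \<longlonglongrightarrow> M * \<bar>t - s\<bar>"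
    by (intro tendsto_intros grid_time_tendsto s t)
  have "norm (approximant k t - approximant k s)
    \<le> M * \<bar>real (grid_index k t) * (1/2) ^ k - real (grid_index k s) * (1/2) ^ k\<bar>" for k
  proof -
    have "norm (approximant k t - approximant k s)
      \<le> M * ((1/2) ^ k * \<bar>real (grid_index k t) - real (grid_index k s)\<bar>)"
      unfolding approximant_def
      by (rule euler_lipschitz) (use grid_index_time s t in auto)
    also have "(1/2) ^ k * \<bar>real (grid_index k t) - real (grid_index k s)\<bar>
      = \<bar>real (grid_index k t) * (1/2) ^ k - real (grid_index k s) * (1/2) ^ k\<bar>"
      by (simp add: abs_mult mult.commute flip: left_diff_distrib)
    finally show ?thesis .
  qed
  then show "\<exists>N. \<forall>k\<ge>N. norm (approximant k t - approximant k s)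
    \<le> M * \<bar>real (grid_index k t) * (1/2) ^ k - real (grid_index k s) * (1/2) ^ k\<bar>" by blast
qed

lemma trajectory_energy:
  assumes p: "p \<in> B x" and st: "0 \<le> s" "s \<le> t" "t \<le> T"
  shows "(norm (trajectory t - x))\<^sup>2 - (norm (trajectory s - x))\<^sup>2
    \<le> 2 * (t - s) * ((p + \<omega> *\<^sub>R trajectory s) \<bullet> (x - trajectory s))
      + 2 * M * (norm p + 2 * L * R + L * norm x) * (t - s)\<^sup>2"
  (is "_ \<le> _ + 2 * M * ?Q * _")
proof (rule LIMSEQ_le)
  have s: "0 \<le> s" "s \<le> T" and t: "0 \<le> t" "t \<le> T" using st by auto
  let ?d = "\<lambda>k. real (grid_index k t) * (1/2) ^ k - real (grid_index k s) * (1/2) ^ k"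
  let ?b = "\<lambda>k. 2 * ?d k * ((p + \<omega> *\<^sub>R approximant k s) \<bullet> (x - approximant k s)) + 2 * M * ?Q * (?d k)\<^sup>2"
  show "(\<lambda>k. (norm (approximant k t - x))\<^sup>2 - (norm (approximant k s - x))\<^sup>2)
    \<longlonglongrightarrow> (norm (trajectory t - x))\<^sup>2 - (norm (trajectory s - x))\<^sup>2"
    by (intro tendsto_intros approximant_tendsto s t)
  show "?b \<longlonglongrightarrow> 2 * (t - s) * ((p + \<omega> *\<^sub>R trajectory s) \<bullet> (x - trajectory s)) + 2 * M * ?Q * (t - s)\<^sup>2"
    by (intro tendsto_intros approximant_tendsto grid_time_tendsto s t)
  have "(norm (approximant k t - x))\<^sup>2 - (norm (approximant k s - x))\<^sup>2 \<le> ?b k" for k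
  proof -
    define n where "n = grid_index k t - grid_index k s"
    have eq: "grid_index k t = grid_index k s + n"
      using grid_index_mono[OF st(2), of k] by (simp add: n_def)
    have d: "?d k = n * (1/2) ^ k" by (simp add: eq algebra_simps)
    show ?thesis
      unfolding d unfolding approximant_def eq
      by (rule euler_energy[OF _ p]) (use grid_index_time[OF t, of k] eq in auto)
  qed
  then show "\<exists>N. \<forall>k\<ge>N. (norm (approximant k t - x))\<^sup>2 - (norm (approximant k s - x))\<^sup>2 \<le> ?b k" by blast
qed

lemma trajectory_dist_point:
  assumes p: "p \<in> B x" and st: "0 \<le> s" "s \<le> t" "t \<le> T"
  shows "norm (trajectory t - x) \<le> exp (L * (t - s)) * (norm (trajectory s - x) + (t - s) * norm (p + \<omega> *\<^sub>R x))"
proof (rule LIMSEQ_le)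
  have s: "0 \<le> s" "s \<le> T" and t: "0 \<le> t" "t \<le> T" using st by auto
  let ?d = "\<lambda>k. real (grid_index k t) * (1/2) ^ k - real (grid_index k s) * (1/2) ^ k"
  let ?b = "\<lambda>k. exp (L * ?d k) * (norm (approximant k s - x) + ?d k * norm (p + \<omega> *\<^sub>R x))"
  show "(\<lambda>k. norm (approximant k t - x)) \<longlonglongrightarrow> norm (trajectory t - x)"
    by (intro tendsto_intros approximant_tendsto s t)
  show "?b \<longlonglongrightarrow> exp (L * (t - s)) * (norm (trajectory s - x) + (t - s) * norm (p + \<omega> *\<^sub>R x))"
    by (intro tendsto_intros approximant_tendsto grid_time_tendsto s t)
  have "norm (approximant k t - x) \<le> ?b k" for k
  proof -
    define n where "n = grid_index k t - grid_index k s"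
    define h where "h = (1/2 :: real) ^ k"
    have h: "h > 0" by (simp add: h_def)
    have eq: "grid_index k t = grid_index k s + n"
      using grid_index_mono[OF st(2), of k] by (simp add: n_def)
    have d: "?d k = n * h" by (simp add: eq h_def algebra_simps)
    have "norm (approximant k t - x)
      \<le> (1 + h * L) ^ n * (norm (approximant k s - x) + n * h * norm (p + \<omega> *\<^sub>R x))"
      unfolding approximant_def eq h_def by (rule euler_dist_point[OF _ p]) simp
    also have "\<dots> \<le> exp (L * (n * h)) * (norm (approximant k s - x) + n * h * norm (p + \<omega> *\<^sub>R x))"
      using growth_factor[OF h, of L n "n * h"] h by (intro mult_right_mono) auto
    finally show ?thesis unfolding d .
  qed
  then show "\<exists>N. \<forall>k\<ge>N. norm (approximant k t - x) \<le> ?b k" by blast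
qed

text \<open>The limit of \<open>euler_contraction\<close>. Since rounding does not commute with
  translation by \<open>d\<close>, the scheme is compared at the index \<open>?j\<close>, which is
  off by a bounded number of steps; that error vanishes with the step size.\<close>

lemma trajectory_translate:
  assumes st: "0 \<le> s" "s \<le> t" and d: "0 \<le> d" "t + d \<le> T"
  shows "norm (trajectory (t + d) - trajectory t) \<le> exp (L * (t - s)) * norm (trajectory (s + d) - trajectory s)"
proof -
  have s: "0 \<le> s" "s \<le> T" and t: "0 \<le> t" "t \<le> T"
    and sd: "0 \<le> s + d" "s + d \<le> T" and td: "0 \<le> t + d" "t + d \<le> T" using st d by auto
  let ?d = "\<lambda>k. real (grid_index k t) * (1/2) ^ k - real (grid_index k s) * (1/2) ^ k"
  let ?b = "\<lambda>k. exp (L * ?d k) * norm (approximant k (s + d) - approximant k s) + M * (4 * (1/2) ^ k)"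
  have "norm (trajectory (t + d) - trajectory t) \<le> exp (L * (t - s)) * norm (trajectory (s + d) - trajectory s) + M * (4 * 0)"
  proof (rule LIMSEQ_le)
    show "(\<lambda>k. norm (approximant k (t + d) - approximant k t)) \<longlonglongrightarrow> norm (trajectory (t + d) - trajectory t)"
      by (intro tendsto_intros approximant_tendsto t td)
    show "?b \<longlonglongrightarrow> exp (L * (t - s)) * norm (trajectory (s + d) - trajectory s) + M * (4 * 0)"
      by (intro tendsto_intros approximant_tendsto grid_time_tendsto s t sd) auto
    have "norm (approximant k (t + d) - approximant k t) \<le> ?b k" for k
    proof -
      define n where "n = grid_index k t - grid_index k s"
      define h where "h = (1/2 :: real) ^ k"
      have h: "h > 0" "h \<le> 1" by (auto simp: h_def power_le_one)
      have eq: "grid_index k t = grid_index k s + n"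
        using grid_index_mono[OF st(2), of k] by (simp add: n_def)
      have dk: "?d k = n * h" by (simp add: eq h_def algebra_simps)
      note bounds = grid_index_bounds[OF s(1), of k] grid_index_bounds[OF t(1), of k]
        grid_index_bounds[OF sd(1), of k] grid_index_bounds[OF td(1), of k]
      let ?i = "grid_index k (t + d)" and ?j = "grid_index k (s + d) + n"
      have nh: "real n * h = real (grid_index k t) * h - real (grid_index k s) * h"
        by (simp add: eq algebra_simps)
      have jh: "real ?j * h = real (grid_index k (s + d)) * h + real n * h" by (simp add: algebra_simps)
      have j: "real ?j * h \<le> T + 1"
        unfolding jh nh using bounds h td by (simp add: h_def)
      \<comment> \<open>Four floors are involved, each losing less than one step.\<close>
      have "\<bar>real ?i * h - real ?j * h\<bar> \<le> 4 * h"
        unfolding jh nh using bounds h by (simp add: h_def)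
      moreover have "\<bar>a * h - b * h\<bar> = h * \<bar>a - b\<bar>" for a b
        using h by (simp add: abs_mult mult.commute flip: left_diff_distrib)
      ultimately have ij: "h * \<bar>real ?i - real ?j\<bar> \<le> 4 * h" by metis
      have "norm (euler h ?i - euler h ?j) \<le> M * (h * \<bar>real ?i - real ?j\<bar>)"
        by (rule euler_lipschitz[OF h(1) _ j]) (use grid_index_time[OF td, of k] in \<open>simp add: h_def\<close>)
      also have "\<dots> \<le> M * (4 * h)" using ij constants_nonneg by (intro mult_left_mono) auto
      finally have 1: "norm (euler h ?i - euler h ?j) \<le> M * (4 * h)" .
      have "norm (euler h ?j - euler h (grid_index k t))
        \<le> (1 + h * L) ^ n * norm (euler h (grid_index k (s + d)) - euler h (grid_index k s))"
        unfolding eq by (rule euler_contraction[OF h(1)])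
      also have "\<dots> \<le> exp (L * (n * h)) * norm (euler h (grid_index k (s + d)) - euler h (grid_index k s))"
        using growth_factor[OF h(1), of L n "n * h"] by (intro mult_right_mono) auto
      finally have 2: "norm (euler h ?j - euler h (grid_index k t))
        \<le> exp (L * (n * h)) * norm (euler h (grid_index k (s + d)) - euler h (grid_index k s))" .
      have "norm (euler h ?i - euler h (grid_index k t))
        \<le> norm (euler h ?i - euler h ?j) + norm (euler h ?j - euler h (grid_index k t))"
        using norm_triangle_ineq[of "euler h ?i - euler h ?j" "euler h ?j - euler h (grid_index k t)"] by simp
      with 1 2 show ?thesis unfolding dk unfolding approximant_def h_def by linarith
    qed
    then show "\<exists>N. \<forall>k\<ge>N. norm (approximant k (t + d) - approximant k t) \<le> ?b k" by blast
  qed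
  then show ?thesis by simp
qed

end

section \<open>Differentiability of the limit\<close>

context implicit_euler
begin

definition quotient :: "real \<Rightarrow> real \<Rightarrow> 'a" where
  "quotient s t = (1 / (t - s)) *\<^sub>R (trajectory t - trajectory s)"

lemma quotient_commute: "quotient s t = quotient t s"
proof -
  have "1 / (s - t) = - (1 / (t - s))" by (metis minus_diff_eq minus_divide_right)
  then show ?thesis unfolding quotient_def by (simp add: scaleR_diff_right)
qed

lemma trajectory_norm:
  assumes "0 \<le> t" "t \<le> T"
  shows "norm (trajectory t) \<le> R"
proof -
  have "norm (trajectory t) \<le> norm (trajectory 0) + norm (trajectory t - trajectory 0)" by (rule norm_triangle_sub)
  also have "norm (trajectory t - trajectory 0) \<le> M * \<bar>t - 0\<bar>" using assms T by (intro trajectory_lipschitz) auto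
  also have "\<dots> \<le> M * (T + 1)" using assms constants_nonneg by (intro mult_left_mono) auto
  finally show ?thesis by (simp add: R_def trajectory_0)
qed

lemma quotient_norm:
  assumes "s \<in> {0..T}" "t \<in> {0..T}" "t \<noteq> s"
  shows "norm (quotient s t) \<le> M"
  using trajectory_lipschitz[of s t] assms by (simp add: quotient_def divide_simps abs_minus_commute)

text \<open>The energy inequality divided by \<open>\<bar>t - s\<bar>\<close>. For
  \<open>t < s\<close> it is based at \<open>t\<close>: the constant \<open>C'\<close> pays for
  moving the data to \<open>s\<close>, and \<open>M\<^sup>2 / 2\<close> for the square of the
  increment, which then has the unfavourable sign.\<close>

lemma quotient_inner_le:
  assumes s: "s \<in> {0..T}" and p: "p \<in> B y"
  obtains C where "\<And>t. t \<in> {0..T} \<Longrightarrow> t \<noteq> s \<Longrightarrow>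
    quotient s t \<bullet> (trajectory s - y) \<le> - ((p + \<omega> *\<^sub>R trajectory s) \<bullet> (trajectory s - y)) + C * \<bar>t - s\<bar>"
proof -
  define Q where "Q = norm p + 2 * L * R + L * norm y"
  define C' where "C' = (norm p + L * R) * M + L * M * (norm y + R)"
  define C where "C = M * Q + M\<^sup>2 / 2 + C'"
  have s': "0 \<le> s" "s \<le> T" using s by auto
  have C'0: "C' \<ge> 0" and MQ: "M * Q \<ge> 0" using constants_nonneg by (auto simp: C'_def Q_def)
  have *: "quotient s t \<bullet> (trajectory s - y) \<le> - ((p + \<omega> *\<^sub>R trajectory s) \<bullet> (trajectory s - y)) + C * \<bar>t - s\<bar>"
    if t: "t \<in> {0..T}" "t \<noteq> s" for t
  proof -
    have t': "0 \<le> t" "t \<le> T" using t by auto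
    define \<delta> where "\<delta> = \<bar>t - s\<bar>"
    have d: "\<delta> > 0" using t by (simp add: \<delta>_def)
    have lip: "norm (trajectory t - trajectory s) \<le> M * \<delta>" unfolding \<delta>_def by (rule trajectory_lipschitz[OF s' t'])
    have lip2: "(norm (trajectory t - trajectory s))\<^sup>2 \<le> M\<^sup>2 * \<delta>\<^sup>2"
      using power_mono[OF lip, of 2] by (simp add: power_mult_distrib)
    have expand: "(norm (trajectory t - y))\<^sup>2 - (norm (trajectory s - y))\<^sup>2
      = 2 * ((trajectory t - trajectory s) \<bullet> (trajectory s - y)) + (norm (trajectory t - trajectory s))\<^sup>2"
      unfolding power2_norm_eq_inner by (simp add: inner_diff_left inner_diff_right inner_commute)
    have "\<delta> * (quotient s t \<bullet> (trajectory s - y)) \<le> \<delta> * (- ((p + \<omega> *\<^sub>R trajectory s) \<bullet> (trajectory s - y)) + C * \<delta>)"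
    proof (cases "t > s")
      case True
      have "(norm (trajectory t - y))\<^sup>2 - (norm (trajectory s - y))\<^sup>2
          \<le> 2 * \<delta> * ((p + \<omega> *\<^sub>R trajectory s) \<bullet> (y - trajectory s)) + 2 * M * Q * \<delta>\<^sup>2"
        using trajectory_energy[OF p s'(1) _ t'(2)] True by (simp add: \<delta>_def Q_def)
      then have "(trajectory t - trajectory s) \<bullet> (trajectory s - y) \<le> \<delta> * ((p + \<omega> *\<^sub>R trajectory s) \<bullet> (y - trajectory s)) + M * Q * \<delta>\<^sup>2"
        using expand zero_le_power2[of "norm (trajectory t - trajectory s)"] by linarith
      also have "\<dots> \<le> \<delta> * ((p + \<omega> *\<^sub>R trajectory s) \<bullet> (y - trajectory s)) + C * \<delta>\<^sup>2"
        using C'0 by (intro add_left_mono mult_right_mono) (auto simp: C_def)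
      also have "(p + \<omega> *\<^sub>R trajectory s) \<bullet> (y - trajectory s) = - ((p + \<omega> *\<^sub>R trajectory s) \<bullet> (trajectory s - y))"
        by (simp add: inner_diff_right)
      finally have "(trajectory t - trajectory s) \<bullet> (trajectory s - y) \<le> \<delta> * (- ((p + \<omega> *\<^sub>R trajectory s) \<bullet> (trajectory s - y)) + C * \<delta>)"
        by (simp only: power2_eq_square distrib_left mult_ac)
      moreover have "\<delta> * (quotient s t \<bullet> (trajectory s - y)) = (trajectory t - trajectory s) \<bullet> (trajectory s - y)"
        using True by (simp add: quotient_def \<delta>_def)
      ultimately show ?thesis by simp
    next
      case False
      then have lt: "t < s" using t by simp
      have "(norm (trajectory s - y))\<^sup>2 - (norm (trajectory t - y))\<^sup>2
          \<le> 2 * \<delta> * ((p + \<omega> *\<^sub>R trajectory t) \<bullet> (y - trajectory t)) + 2 * M * Q * \<delta>\<^sup>2"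
        using trajectory_energy[OF p t'(1) _ s'(2)] lt by (simp add: \<delta>_def Q_def)
      then have 1: "- ((trajectory t - trajectory s) \<bullet> (trajectory s - y))
          \<le> \<delta> * ((p + \<omega> *\<^sub>R trajectory t) \<bullet> (y - trajectory t)) + M * Q * \<delta>\<^sup>2 + M\<^sup>2 / 2 * \<delta>\<^sup>2"
        using expand lip2 by linarith
      have 2: "(p + \<omega> *\<^sub>R trajectory t) \<bullet> (y - trajectory t) \<le> - ((p + \<omega> *\<^sub>R trajectory s) \<bullet> (trajectory s - y)) + C' * \<delta>"
      proof -
        have "(p + \<omega> *\<^sub>R trajectory t) \<bullet> (y - trajectory t) = - ((p + \<omega> *\<^sub>R trajectory s) \<bullet> (trajectory s - y))
          + (p + \<omega> *\<^sub>R trajectory t) \<bullet> (trajectory s - trajectory t) + \<omega> * ((trajectory t - trajectory s) \<bullet> (y - trajectory s))"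
          by (simp add: inner_diff_left inner_diff_right inner_add_left algebra_simps)
        moreover have "(p + \<omega> *\<^sub>R trajectory t) \<bullet> (trajectory s - trajectory t) \<le> (norm p + L * R) * (M * \<delta>)"
        proof -
          have "(p + \<omega> *\<^sub>R trajectory t) \<bullet> (trajectory s - trajectory t) \<le> norm (p + \<omega> *\<^sub>R trajectory t) * norm (trajectory s - trajectory t)"
            by (rule norm_cauchy_schwarz)
          also have "\<dots> \<le> (norm p + L * R) * (M * \<delta>)"
          proof (rule mult_mono)
            have "L * norm (trajectory t) \<le> L * R" using trajectory_norm[OF t'] by (intro mult_left_mono) auto
            then show "norm (p + \<omega> *\<^sub>R trajectory t) \<le> norm p + L * R"
              using norm_triangle_ineq[of p "\<omega> *\<^sub>R trajectory t"] by simp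
          qed (use lip constants_nonneg in \<open>auto simp: norm_minus_commute\<close>)
          finally show ?thesis .
        qed
        moreover have "\<omega> * ((trajectory t - trajectory s) \<bullet> (y - trajectory s)) \<le> L * (M * \<delta> * (norm y + R))"
        proof -
          have "\<omega> * ((trajectory t - trajectory s) \<bullet> (y - trajectory s)) \<le> \<bar>\<omega> * ((trajectory t - trajectory s) \<bullet> (y - trajectory s))\<bar>" by simp
          also have "\<dots> \<le> L * (norm (trajectory t - trajectory s) * norm (y - trajectory s))"
            unfolding abs_mult by (intro mult_left_mono Cauchy_Schwarz_ineq2) auto
          also have "\<dots> \<le> L * (M * \<delta> * (norm y + R))"
            using lip trajectory_norm[OF s'] norm_triangle_ineq4[of y "trajectory s"] constants_nonneg d
            by (intro mult_left_mono mult_mono) auto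
          finally show ?thesis .
        qed
        ultimately show ?thesis by (simp add: C'_def algebra_simps)
      qed
      have "- ((trajectory t - trajectory s) \<bullet> (trajectory s - y)) \<le> \<delta> * (- ((p + \<omega> *\<^sub>R trajectory s) \<bullet> (trajectory s - y)) + C' * \<delta>)
          + M * Q * \<delta>\<^sup>2 + M\<^sup>2 / 2 * \<delta>\<^sup>2"
        using 1 mult_left_mono[OF 2, of \<delta>] d by linarith
      also have "\<dots> = \<delta> * (- ((p + \<omega> *\<^sub>R trajectory s) \<bullet> (trajectory s - y)) + C * \<delta>)"
        unfolding C_def power2_eq_square by (simp only: algebra_simps)
      finally have "- ((trajectory t - trajectory s) \<bullet> (trajectory s - y)) \<le> \<delta> * (- ((p + \<omega> *\<^sub>R trajectory s) \<bullet> (trajectory s - y)) + C * \<delta>)" .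
      moreover have "\<delta> * (quotient s t \<bullet> (trajectory s - y)) = - ((trajectory t - trajectory s) \<bullet> (trajectory s - y))"
      proof -
        have "\<delta> * (1 / (t - s)) = - 1" using lt by (simp add: \<delta>_def field_simps)
        moreover have "\<delta> * (quotient s t \<bullet> (trajectory s - y))
            = (\<delta> * (1 / (t - s))) * ((trajectory t - trajectory s) \<bullet> (trajectory s - y))"
          by (simp only: quotient_def inner_scaleR_left mult.assoc)
        ultimately show ?thesis by simp
      qed
      ultimately show ?thesis by simp
    qed
    then show ?thesis using d by (simp add: \<delta>_def)
  qed
  show thesis by (rule that) (rule *)
qed

lemma eventually_in_punctured:
  "\<forall>\<^sub>F t in at s within S. t \<in> S \<and> t \<noteq> s"
  by (auto simp: eventually_at_filter)

text \<open>Along a Yosida approximation \<open>P n\<close> of \<open>G\<close> the energy inequality gives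
  \<open>limsup \<langle>quotient s t, P n\<rangle> \<le> - \<parallel>P n\<parallel>\<^sup>2\<close>; together with \<open>limsup \<parallel>quotient s t\<parallel> \<le> \<parallel>G\<parallel>\<close> this
  forces strong convergence of the quotients to \<open>- G\<close>.\<close>

lemma velocity_exists:
  assumes s: "s \<in> {0..T}"
  shows "\<exists>G. G - \<omega> *\<^sub>R trajectory s \<in> B (trajectory s) \<and>
    (\<forall>S b. S \<subseteq> {0..T} \<longrightarrow> (b \<longlongrightarrow> norm G) (at s within S) \<longrightarrow>
      (\<forall>t\<in>S - {s}. norm (quotient s t) \<le> b t) \<longrightarrow> (quotient s \<longlongrightarrow> - G) (at s within S))"
proof -
  let ?c = "\<omega> *\<^sub>R trajectory s"
  interpret S: maximal_monotone "\<lambda>x. {p. p - ?c \<in> B x}" by (rule shift)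
  \<comment> \<open>Here \<open>trajectory s - y = \<mu> *\<^sub>R p\<close>, so as \<open>t\<close>
    tends to \<open>s\<close> the inequality becomes
    \<open>\<mu> * (norm p)\<^sup>2 \<le> M * (\<mu> * norm p)\<close>. The Lipschitz constant of
    the arc thus bounds all Yosida approximations, which puts every point of the arc into the domain
    of \<open>B\<close>.\<close>
  have yos: "norm p \<le> M" if mu: "\<mu> > 0" and p: "p \<in> {p. p - ?c \<in> B y}" and y: "y + \<mu> *\<^sub>R p = trajectory s" for \<mu> y p
  proof -
    have diff: "trajectory s - y = \<mu> *\<^sub>R p" using y by (simp add: algebra_simps)
    from p have "p - ?c \<in> B y" by simp
    from quotient_inner_le[OF s this] obtain C where
      C: "\<And>t. t \<in> {0..T} \<Longrightarrow> t \<noteq> s \<Longrightarrow> quotient s t \<bullet> (trajectory s - y) \<le> - (p \<bullet> (trajectory s - y)) + C * \<bar>t - s\<bar>"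
      by auto
    have "\<mu> * (norm p)\<^sup>2 \<le> M * (\<mu> * norm p) + C * \<bar>s - s\<bar>"
    proof (rule tendsto_le)
      show "\<not> trivial_limit (at s within {0..T})" using s T by (simp add: trivial_limit_within)
      show "((\<lambda>t. M * (\<mu> * norm p) + C * \<bar>t - s\<bar>) \<longlongrightarrow> M * (\<mu> * norm p) + C * \<bar>s - s\<bar>) (at s within {0..T})"
        by (intro tendsto_intros)
      show "\<forall>\<^sub>F t in at s within {0..T}. \<mu> * (norm p)\<^sup>2 \<le> M * (\<mu> * norm p) + C * \<bar>t - s\<bar>"
      proof (rule eventually_mono[OF eventually_in_punctured])
        fix t assume t: "t \<in> {0..T} \<and> t \<noteq> s"
        have "- (quotient s t \<bullet> (trajectory s - y)) \<le> norm (quotient s t) * norm (trajectory s - y)"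
          using Cauchy_Schwarz_ineq2[of "quotient s t" "trajectory s - y"] by linarith
        also have "\<dots> \<le> M * norm (trajectory s - y)" using quotient_norm[OF s] t by (intro mult_right_mono) auto
        finally have "- (quotient s t \<bullet> (trajectory s - y)) \<le> M * (\<mu> * norm p)" using mu by (simp add: diff)
        moreover have "p \<bullet> (trajectory s - y) = \<mu> * (norm p)\<^sup>2" by (simp add: diff power2_norm_eq_inner)
        ultimately show "\<mu> * (norm p)\<^sup>2 \<le> M * (\<mu> * norm p) + C * \<bar>t - s\<bar>" using C[of t] t by linarith
      qed
    qed simp
    then have "\<mu> * (norm p * norm p) \<le> \<mu> * (M * norm p)" by (simp add: power2_eq_square mult_ac)
    then have "norm p * norm p \<le> M * norm p" using mu by simp
    then show ?thesis using constants_nonneg by (cases "p = 0") auto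
  qed
  obtain G P Y l where G: "G - ?c \<in> B (trajectory s)" and PG: "P \<longlonglongrightarrow> G"
    and P: "\<And>n. P n - ?c \<in> B (Y n)" and Y: "\<And>n. trajectory s - Y n = l n *\<^sub>R P n" and l: "\<And>n. l n > (0::real)"
  proof -
    have "\<exists>g P Y l. g \<in> {p. p - ?c \<in> B (trajectory s)} \<and> P \<longlonglongrightarrow> g \<and>
      (\<forall>n. P n \<in> {p. p - ?c \<in> B (Y n)} \<and> trajectory s - Y n = l n *\<^sub>R P n \<and> l n > (0::real))"
      by (rule S.yosida_converges) (rule yos)
    then show thesis using that by blast
  qed
  have "(quotient s \<longlongrightarrow> - G) (at s within S)"
    if S: "S \<subseteq> {0..T}" and b: "(b \<longlongrightarrow> norm G) (at s within S)"
      and qb: "\<forall>t\<in>S - {s}. norm (quotient s t) \<le> b t" for S b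
  proof -
    \<comment> \<open>The limit, as \<open>t\<close> tends to \<open>s\<close>, of the bound on
      \<open>(norm (quotient s t + G))\<^sup>2\<close> obtained by testing with \<open>P n\<close>;
      the bound on the quotients themselves tends to \<open>norm G\<close>.\<close>
    define e where "e n = (norm G)\<^sup>2 - 2 * (norm (P n))\<^sup>2 + 2 * (M * norm (G - P n)) + (norm G)\<^sup>2" for n
    have "e \<longlonglongrightarrow> (norm G)\<^sup>2 - 2 * (norm G)\<^sup>2 + 2 * (M * norm (G - G)) + (norm G)\<^sup>2"
      unfolding e_def by (intro tendsto_intros PG)
    then have e0: "e \<longlonglongrightarrow> 0" by simp
    have bnd: "\<exists>C. \<forall>t\<in>S - {s}. (norm (quotient s t + G))\<^sup>2
      \<le> (b t)\<^sup>2 - 2 * (norm (P n))\<^sup>2 + 2 * (M * norm (G - P n)) + (norm G)\<^sup>2 + C * \<bar>t - s\<bar>" for n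
    proof -
      obtain C where C: "\<And>t. t \<in> {0..T} \<Longrightarrow> t \<noteq> s \<Longrightarrow>
        quotient s t \<bullet> (trajectory s - Y n) \<le> - (P n \<bullet> (trajectory s - Y n)) + C * \<bar>t - s\<bar>"
        using quotient_inner_le[OF s P[of n]] by auto
      have "(norm (quotient s t + G))\<^sup>2
        \<le> (b t)\<^sup>2 - 2 * (norm (P n))\<^sup>2 + 2 * (M * norm (G - P n)) + (norm G)\<^sup>2 + 2 * C / l n * \<bar>t - s\<bar>"
        if t: "t \<in> S - {s}" for t
      proof -
        have t': "t \<in> {0..T}" "t \<noteq> s" using t S by auto
        have "l n * (quotient s t \<bullet> P n) \<le> - (l n * (norm (P n))\<^sup>2) + C * \<bar>t - s\<bar>"
          using C[OF t'] by (simp add: Y power2_norm_eq_inner)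
        then have "quotient s t \<bullet> P n \<le> - (norm (P n))\<^sup>2 + C / l n * \<bar>t - s\<bar>"
          using l[of n] by (simp add: field_simps)
        moreover have "quotient s t \<bullet> (G - P n) \<le> M * norm (G - P n)"
          using norm_cauchy_schwarz[of "quotient s t" "G - P n"]
            mult_right_mono[OF quotient_norm[OF s t'], of "norm (G - P n)"] by simp
        moreover have "quotient s t \<bullet> G = quotient s t \<bullet> P n + quotient s t \<bullet> (G - P n)"
          by (simp add: inner_diff_right)
        moreover have "(norm (quotient s t + G))\<^sup>2
          = (norm (quotient s t))\<^sup>2 + 2 * (quotient s t \<bullet> G) + (norm G)\<^sup>2"
          unfolding power2_norm_eq_inner by (simp add: inner_add_left inner_add_right inner_commute)
        moreover have "(norm (quotient s t))\<^sup>2 \<le> (b t)\<^sup>2"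
          using qb t by (intro power_mono) auto
        ultimately show ?thesis by argo
      qed
      then show ?thesis by blast
    qed
    show ?thesis
    proof (rule tendstoI)
      fix \<epsilon> :: real assume eps: "\<epsilon> > 0"
      then have "\<forall>\<^sub>F n in sequentially. e n < \<epsilon>\<^sup>2"
        using order_tendstoD(2)[OF e0] by simp
      then obtain n where n: "e n < \<epsilon>\<^sup>2" by (metis eventually_sequentially order_refl)
      obtain C where C: "\<And>t. t \<in> S - {s} \<Longrightarrow> (norm (quotient s t + G))\<^sup>2
        \<le> (b t)\<^sup>2 - 2 * (norm (P n))\<^sup>2 + 2 * (M * norm (G - P n)) + (norm G)\<^sup>2 + C * \<bar>t - s\<bar>"
        using bnd[of n] by blast
      have "((\<lambda>t. (b t)\<^sup>2 - 2 * (norm (P n))\<^sup>2 + 2 * (M * norm (G - P n)) + (norm G)\<^sup>2 + C * \<bar>t - s\<bar>)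
        \<longlongrightarrow> (norm G)\<^sup>2 - 2 * (norm (P n))\<^sup>2 + 2 * (M * norm (G - P n)) + (norm G)\<^sup>2 + C * \<bar>s - s\<bar>) (at s within S)"
        by (intro tendsto_intros b)
      moreover have "(norm G)\<^sup>2 - 2 * (norm (P n))\<^sup>2 + 2 * (M * norm (G - P n)) + (norm G)\<^sup>2 + C * \<bar>s - s\<bar> < \<epsilon>\<^sup>2"
        using n by (simp add: e_def)
      ultimately have "\<forall>\<^sub>F t in at s within S. (b t)\<^sup>2 - 2 * (norm (P n))\<^sup>2 + 2 * (M * norm (G - P n))
          + (norm G)\<^sup>2 + C * \<bar>t - s\<bar> < \<epsilon>\<^sup>2"
        by (rule order_tendstoD(2))
      then show "\<forall>\<^sub>F t in at s within S. dist (quotient s t) (- G) < \<epsilon>"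
      proof (rule eventually_elim2[OF _ eventually_in_punctured])
        fix t assume 1: "(b t)\<^sup>2 - 2 * (norm (P n))\<^sup>2 + 2 * (M * norm (G - P n))
          + (norm G)\<^sup>2 + C * \<bar>t - s\<bar> < \<epsilon>\<^sup>2" and t: "t \<in> S \<and> t \<noteq> s"
        have "(norm (quotient s t + G))\<^sup>2 < \<epsilon>\<^sup>2" using C[of t] 1 t by auto
        then have "norm (quotient s t + G) < \<epsilon>" using eps by (meson less_imp_le power_less_imp_less_base)
        then show "dist (quotient s t) (- G) < \<epsilon>" by (simp add: dist_norm)
      qed
    qed
  qed
  with G show ?thesis by blast
qed

text \<open>The quantification over \<open>S\<close> and \<open>b\<close> lets one and the same
  choice serve for the right derivative and for the two-sided one.\<close>

definition velocity :: "real \<Rightarrow> 'a" where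
  "velocity s = (SOME G. G - \<omega> *\<^sub>R trajectory s \<in> B (trajectory s) \<and>
    (\<forall>S b. S \<subseteq> {0..T} \<longrightarrow> (b \<longlongrightarrow> norm G) (at s within S) \<longrightarrow>
      (\<forall>t\<in>S - {s}. norm (quotient s t) \<le> b t) \<longrightarrow> (quotient s \<longlongrightarrow> - G) (at s within S)))"

lemma velocity_in: "s \<in> {0..T} \<Longrightarrow> velocity s - \<omega> *\<^sub>R trajectory s \<in> B (trajectory s)"
  using someI_ex[OF velocity_exists] unfolding velocity_def by blast

lemma quotient_tendsto:
  assumes "s \<in> {0..T}" "S \<subseteq> {0..T}" "(b \<longlongrightarrow> norm (velocity s)) (at s within S)"
    and "\<And>t. t \<in> S \<Longrightarrow> t \<noteq> s \<Longrightarrow> norm (quotient s t) \<le> b t"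
  shows "(quotient s \<longlongrightarrow> - velocity s) (at s within S)"
  using someI_ex[OF velocity_exists[OF assms(1)]] assms(2-) unfolding velocity_def by blast

text \<open>In \<open>trajectory_dist_point\<close> take \<open>x = trajectory s\<close> and
  \<open>p = velocity s - \<omega> *\<^sub>R x\<close>; the residual is then exactly
  \<open>velocity s\<close>.\<close>

lemma quotient_right_bound:
  assumes "0 \<le> s" "s < t" "t \<le> T"
  shows "norm (quotient s t) \<le> exp (L * (t - s)) * norm (velocity s)"
proof -
  have "norm (trajectory t - trajectory s) \<le> exp (L * (t - s)) * ((t - s) * norm (velocity s))"
    using trajectory_dist_point[OF velocity_in[of s], of s t] assms by simp
  then show ?thesis using assms by (simp add: quotient_def pos_divide_le_eq mult_ac)
qed

text \<open>The bound of \<open>quotient_right_bound\<close> tends to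
  \<open>norm (velocity s)\<close>, just what \<open>quotient_tendsto\<close> requires; so no time
  before \<open>T\<close> is exceptional for the right derivative.\<close>

lemma quotient_right_tendsto:
  assumes s: "0 \<le> s" "s < T"
  shows "((\<lambda>d. quotient s (s + d)) \<longlongrightarrow> - velocity s) (at_right 0)"
proof -
  have "(quotient s \<longlongrightarrow> - velocity s) (at s within {s..T})"
  proof (rule quotient_tendsto)
    have "((\<lambda>t. exp (L * (t - s)) * norm (velocity s)) \<longlongrightarrow> exp (L * (s - s)) * norm (velocity s)) (at s within {s..T})"
      by (intro tendsto_intros)
    then show "((\<lambda>t. exp (L * (t - s)) * norm (velocity s)) \<longlongrightarrow> norm (velocity s)) (at s within {s..T})" by simp
  qed (use s quotient_right_bound in auto)
  then have "(quotient s \<longlongrightarrow> - velocity s) (at_right s)"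
    using s by (simp add: at_within_Icc_at_right)
  then show ?thesis by (simp add: filterlim_at_right_to_0[of _ _ s] add.commute)
qed

text \<open>Divide \<open>trajectory_translate\<close> by \<open>d\<close> and let \<open>d\<close>
  tend to 0 from the right; \<open>t < T\<close> leaves room for the quotient.\<close>

lemma velocity_growth:
  assumes st: "0 \<le> s" "s \<le> t" "t < T"
  shows "norm (velocity t) \<le> exp (L * (t - s)) * norm (velocity s)"
proof -
  have "norm (- velocity t) \<le> exp (L * (t - s)) * norm (- velocity s)"
  proof (rule tendsto_le)
    show "((\<lambda>d. norm (quotient t (t + d))) \<longlongrightarrow> norm (- velocity t)) (at_right 0)"
      using st by (intro tendsto_intros quotient_right_tendsto) auto
    show "((\<lambda>d. exp (L * (t - s)) * norm (quotient s (s + d))) \<longlongrightarrow> exp (L * (t - s)) * norm (- velocity s)) (at_right 0)"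
      using st by (intro tendsto_intros quotient_right_tendsto) auto
    have "\<forall>\<^sub>F d in at_right 0. d \<in> {0<..<T - t}" using st by (intro eventually_at_right_real) simp
    then show "\<forall>\<^sub>F d in at_right 0. norm (quotient t (t + d)) \<le> exp (L * (t - s)) * norm (quotient s (s + d))"
    proof (rule eventually_mono)
      fix d assume d: "d \<in> {0<..<T - t}"
      have "norm (trajectory (t + d) - trajectory t) \<le> exp (L * (t - s)) * norm (trajectory (s + d) - trajectory s)"
        by (rule trajectory_translate) (use st d in auto)
      then show "norm (quotient t (t + d)) \<le> exp (L * (t - s)) * norm (quotient s (s + d))"
        using d by (simp add: quotient_def divide_right_mono)
    qed
  qed simp
  then show ?thesis by simp
qed

text \<open>By \<open>velocity_growth\<close> the weighted speed below is monotone; at its points of continuity the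
  left difference quotients satisfy the same norm bound as the right ones.\<close>

definition exceptional_times :: "real set" where
  "exceptional_times = {s\<in>{0<..<T}. \<not> isCont (\<lambda>t. - (exp (- (L * t)) * norm (velocity t))) s}"

lemma countable_exceptional_times: "countable exceptional_times"
  unfolding exceptional_times_def
proof (rule mono_on_ctble_discont_open)
  show "mono_on {0<..<T} (\<lambda>t. - (exp (- (L * t)) * norm (velocity t)))"
  proof (rule mono_onI)
    fix s t assume st: "s \<in> {0<..<T}" "t \<in> {0<..<T}" "s \<le> t"
    have "exp (- (L * t)) * norm (velocity t) \<le> exp (- (L * t)) * (exp (L * (t - s)) * norm (velocity s))"
      using velocity_growth[of s t] st by (intro mult_left_mono) auto
    also have "\<dots> = exp (- (L * s)) * norm (velocity s)"
      by (simp add: mult.assoc[symmetric] exp_add[symmetric] algebra_simps)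
    finally show "- (exp (- (L * s)) * norm (velocity s)) \<le> - (exp (- (L * t)) * norm (velocity t))" by simp
  qed
qed simp

lemma trajectory_has_derivative:
  assumes s: "s \<in> {0<..<T}" "s \<notin> exceptional_times"
  shows "(trajectory has_vector_derivative - velocity s) (at s within {0..T})"
proof -
  define N where "N t = exp (- (L * t)) * norm (velocity t)" for t
  have "isCont (\<lambda>t. - N t) s" using s by (simp add: exceptional_times_def N_def)
  then have "isCont N s" using isCont_minus by fastforce
  then have N: "(N \<longlongrightarrow> N s) (at s within {0..T})"
    unfolding isCont_def by (rule tendsto_within_subset) simp
  have N0: "0 \<le> N t" for t by (simp add: N_def)
  have vN: "norm (velocity t) = exp (L * t) * N t" for t
    by (simp add: N_def mult.assoc[symmetric] exp_add[symmetric])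
  have "(quotient s \<longlongrightarrow> - velocity s) (at s within {0..T})"
  proof (rule quotient_tendsto)
    \<comment> \<open>The maximum covers both sides: for \<open>t > s\<close> the quotient is
      controlled by the speed at \<open>s\<close>, for \<open>t < s\<close> it is a right quotient
      at \<open>t\<close>, controlled by the speed there. Continuity of \<open>N\<close> at
      \<open>s\<close> makes the two bounds agree in the limit.\<close>
    have "((\<lambda>t. exp (L * \<bar>t - s\<bar>) * max (norm (velocity s)) (exp (L * t) * N t))
      \<longlongrightarrow> exp (L * \<bar>s - s\<bar>) * max (norm (velocity s)) (exp (L * s) * N s)) (at s within {0..T})"
      by (intro tendsto_intros N)
    then show "((\<lambda>t. exp (L * \<bar>t - s\<bar>) * max (norm (velocity s)) (exp (L * t) * N t))
      \<longlongrightarrow> norm (velocity s)) (at s within {0..T})"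
      by (simp add: vN[symmetric])
    fix t assume t: "t \<in> {0..T}" "t \<noteq> s"
    show "norm (quotient s t) \<le> exp (L * \<bar>t - s\<bar>) * max (norm (velocity s)) (exp (L * t) * N t)"
    proof (cases "s < t")
      case True
      have "norm (quotient s t) \<le> exp (L * (t - s)) * norm (velocity s)"
        using quotient_right_bound[of s t] s t True by auto
      also have "\<dots> \<le> exp (L * \<bar>t - s\<bar>) * max (norm (velocity s)) (exp (L * t) * N t)"
        using True by (intro mult_mono) auto
      finally show ?thesis .
    next
      case False
      have "norm (quotient t s) \<le> exp (L * (s - t)) * norm (velocity t)"
        using quotient_right_bound[of t s] s t False by auto
      also have "\<dots> \<le> exp (L * \<bar>t - s\<bar>) * max (norm (velocity s)) (exp (L * t) * N t)"
        using False by (intro mult_mono) (auto simp: vN N0)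
      finally show ?thesis by (simp add: quotient_commute)
    qed
  qed (use s in auto)
  then have "((\<lambda>t. quotient s t - (- velocity s)) \<longlongrightarrow> 0) (at s within {0..T})"
    by (simp only: LIM_zero_iff)
  then have lim: "((\<lambda>t. norm (quotient s t + velocity s)) \<longlongrightarrow> 0) (at s within {0..T})"
    using tendsto_norm_zero by fastforce
  have "((\<lambda>t. norm (trajectory t - trajectory s - (t - s) *\<^sub>R (- velocity s)) / norm (t - s)) \<longlongrightarrow> 0) (at s within {0..T})"
  proof (rule Lim_transform_eventually[OF lim])
    show "\<forall>\<^sub>F t in at s within {0..T}. norm (quotient s t + velocity s)
      = norm (trajectory t - trajectory s - (t - s) *\<^sub>R (- velocity s)) / norm (t - s)"
    proof (rule eventually_mono[OF eventually_in_punctured])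
      fix t assume t: "t \<in> {0..T} \<and> t \<noteq> s"
      have "trajectory t - trajectory s - (t - s) *\<^sub>R (- velocity s) = (t - s) *\<^sub>R (quotient s t + velocity s)"
        using t by (simp add: quotient_def scaleR_add_right)
      then show "norm (quotient s t + velocity s)
        = norm (trajectory t - trajectory s - (t - s) *\<^sub>R (- velocity s)) / norm (t - s)"
        using t by simp
    qed
  qed
  then show ?thesis
    unfolding has_vector_derivative_def has_derivative_iff_norm
    by (simp add: bounded_linear_minus bounded_linear_scaleR_left)
qed

end

section \<open>Lipschitz arcs\<close>

lemma lipschitz_imp_absolutely_continuous_arc:
  assumes lip: "\<And>s t. s \<in> {0..T} \<Longrightarrow> t \<in> {0..T} \<Longrightarrow> norm (u t - u s) \<le> M * \<bar>t - s\<bar>" and M: "M \<ge> 0"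
  shows "absolutely_continuous_arc T u"
  unfolding absolutely_continuous_arc_def
proof (intro allI impI)
  fix \<epsilon> :: real assume eps: "\<epsilon> > 0"
  show "\<exists>\<delta>>0. \<forall>(n::nat) a b. (\<forall>i<n. 0 \<le> a i \<and> a i \<le> b i \<and> b i \<le> T) \<and>
      disjoint_family_on (\<lambda>i. {a i<..<b i}) {..<n} \<and> (\<Sum>i<n. b i - a i) < \<delta> \<longrightarrow>
      (\<Sum>i<n. norm (u (b i) - u (a i))) < \<epsilon>"
  proof (intro exI[of _ "\<epsilon> / (M + 1)"] conjI allI impI)
    fix n :: nat and a b :: "nat \<Rightarrow> real"
    assume ab: "(\<forall>i<n. 0 \<le> a i \<and> a i \<le> b i \<and> b i \<le> T) \<and>
      disjoint_family_on (\<lambda>i. {a i<..<b i}) {..<n} \<and> (\<Sum>i<n. b i - a i) < \<epsilon> / (M + 1)"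
    have "(\<Sum>i<n. norm (u (b i) - u (a i))) \<le> (\<Sum>i<n. M * (b i - a i))"
    proof (rule sum_mono)
      fix i assume "i \<in> {..<n}"
      then have "0 \<le> a i" "a i \<le> b i" "b i \<le> T" using ab by auto
      then show "norm (u (b i) - u (a i)) \<le> M * (b i - a i)" using lip[of "a i" "b i"] by simp
    qed
    also have "\<dots> = M * (\<Sum>i<n. b i - a i)" by (simp add: sum_distrib_left)
    also have "\<dots> \<le> M * (\<epsilon> / (M + 1))" using ab M by (intro mult_left_mono) auto
    also have "\<dots> < \<epsilon>" using eps M by (simp add: field_simps)
    finally show "(\<Sum>i<n. norm (u (b i) - u (a i))) < \<epsilon>" .
  qed (use eps M in simp)
qed

lemma AE_lebesgue_on_not_in_countable:
  assumes "countable (Z :: real set)" and S: "S \<in> sets lebesgue"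
  shows "AE t in lebesgue_on S. t \<notin> Z"
proof -
  have "AE t in lebesgue. t \<notin> Z"
    by (intro AE_completion AE_not_in countable_imp_null_set_lborel assms)
  then show ?thesis using S by (subst AE_restrict_space_iff) auto
qed

text \<open>The difference quotient over the grid cell containing \<open>t\<close>. It takes
  finitely many values on \<open>{0..T}\<close>, so it is simple whatever the size of the space.
  Cells may stick out beyond \<open>T\<close>, which is harmless in the limit at points
  \<open>t < T\<close>.\<close>

definition grid_quotient :: "(real \<Rightarrow> 'a::real_normed_vector) \<Rightarrow> nat \<Rightarrow> real \<Rightarrow> 'a" where
  "grid_quotient u n t = real (Suc n) *\<^sub>R
    (u ((of_int \<lfloor>t * real (Suc n)\<rfloor> + 1) / real (Suc n)) - u (of_int \<lfloor>t * real (Suc n)\<rfloor> / real (Suc n)))"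

lemma simple_function_grid_quotient:
  "simple_function (lebesgue_on {0..T}) (grid_quotient u n)"
proof -
  have "(\<lambda>t. t * real (Suc n)) \<in> borel_measurable (lebesgue_on {0..T})"
    by (intro measurable_restrict_space1 measurable_completion) simp
  from measurable_compose[OF this measurable_real_floor]
  have meas: "(\<lambda>t. \<lfloor>t * real (Suc n)\<rfloor>) \<in> measurable (lebesgue_on {0..T}) (count_space UNIV)" .
  have sf: "simple_function (lebesgue_on {0..T}) (\<lambda>t. \<lfloor>t * real (Suc n)\<rfloor>)"
    unfolding simple_function_def
  proof (intro conjI ballI)
    have "(\<lambda>t. \<lfloor>t * real (Suc n)\<rfloor>) ` space (lebesgue_on {0..T}) \<subseteq> {0..\<lfloor>T * real (Suc n)\<rfloor>}"
      by (auto intro!: floor_mono mult_right_mono)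
    then show "finite ((\<lambda>t. \<lfloor>t * real (Suc n)\<rfloor>) ` space (lebesgue_on {0..T}))"
      by (rule finite_subset) simp
    show "(\<lambda>t. \<lfloor>t * real (Suc n)\<rfloor>) -` {k} \<inter> space (lebesgue_on {0..T}) \<in> sets (lebesgue_on {0..T})" for k
      using measurable_sets[OF meas, of "{k}"] by simp
  qed
  have "grid_quotient u n = (\<lambda>k. real (Suc n) *\<^sub>R (u ((of_int k + 1) / real (Suc n)) - u (of_int k / real (Suc n))))
      \<circ> (\<lambda>t. \<lfloor>t * real (Suc n)\<rfloor>)"
    by (simp add: fun_eq_iff grid_quotient_def)
  then show ?thesis using simple_function_compose[OF sf] by metis
qed

text \<open>The cell contains \<open>t\<close>, so both endpoint errors are measured from
  \<open>t\<close> and their bounds add up to a multiple of the cell length.\<close>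

lemma grid_quotient_tendsto:
  assumes d: "(u has_vector_derivative d) (at t within {0..T})" and t: "0 < t" "t < T"
  shows "(\<lambda>n. grid_quotient u n t) \<longlonglongrightarrow> d"
proof (rule LIMSEQ_I)
  fix e :: real assume e: "e > 0"
  obtain \<delta> where \<delta>: "\<delta> > 0" and straddle: "\<And>y. y \<in> {0..T} \<Longrightarrow> \<bar>y - t\<bar> < \<delta> \<Longrightarrow>
      norm (u y - u t - (y - t) *\<^sub>R d) \<le> (e/2) * \<bar>y - t\<bar>"
    using d e unfolding has_vector_derivative_def has_derivative_within_alt
    by (metis half_gt_zero real_norm_def)
  obtain N where N: "1 / Suc N < min \<delta> (T - t)"
    using nat_approx_posE[of "min \<delta> (T - t)"] \<delta> t by auto
  show "\<exists>N. \<forall>n\<ge>N. norm (grid_quotient u n t - d) < e"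
  proof (intro exI[of _ N] allI impI)
    fix n assume n: "n \<ge> N"
    define m where "m = real (Suc n)"
    define a b where "a = of_int \<lfloor>t * m\<rfloor> / m" and "b = (of_int \<lfloor>t * m\<rfloor> + 1) / m"
    have m: "m > 0" by (simp add: m_def)
    have small: "1 / m < \<delta>" "1 / m < T - t"
    proof -
      have "1 / m \<le> 1 / Suc N" using n unfolding m_def by (intro frac_le) auto
      then show "1 / m < \<delta>" "1 / m < T - t" using N by auto
    qed
    have ab: "b - a = 1 / m" by (simp add: a_def b_def diff_divide_distrib[symmetric])
    have at: "a \<le> t" "t < b" using m floor_correct[of "t * m"] by (simp_all add: a_def b_def pos_divide_le_eq pos_less_divide_eq)
    have a0: "0 \<le> a" using m t by (simp add: a_def)
    have a: "a \<in> {0..T}" "\<bar>a - t\<bar> < \<delta>" and b: "b \<in> {0..T}" "\<bar>b - t\<bar> < \<delta>"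
      using ab at small a0 t by auto
    have "(u b - u a) - (1 / m) *\<^sub>R d = (u b - u t - (b - t) *\<^sub>R d) - (u a - u t - (a - t) *\<^sub>R d)"
      unfolding ab[symmetric] by (simp add: scaleR_diff_left)
    then have "norm ((u b - u a) - (1 / m) *\<^sub>R d)
        \<le> norm (u b - u t - (b - t) *\<^sub>R d) + norm (u a - u t - (a - t) *\<^sub>R d)"
      using norm_triangle_ineq4 by metis
    also have "\<dots> \<le> (e/2) * \<bar>b - t\<bar> + (e/2) * \<bar>a - t\<bar>"
      by (intro add_mono straddle a b)
    also have "\<dots> = (e/2) * (1 / m)" using at ab by (simp flip: ab distrib_left)
    finally have le: "norm ((u b - u a) - (1 / m) *\<^sub>R d) \<le> (e/2) * (1 / m)" .
    have "grid_quotient u n t - d = m *\<^sub>R ((u b - u a) - (1 / m) *\<^sub>R d)"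
      using m unfolding grid_quotient_def m_def[symmetric] a_def b_def by (simp add: scaleR_diff_right)
    then have "norm (grid_quotient u n t - d) = m * norm ((u b - u a) - (1 / m) *\<^sub>R d)"
      using m by (simp only: norm_scaleR)
    also have "\<dots> \<le> m * ((e/2) * (1 / m))" using le m by (intro mult_left_mono) auto
    also have "\<dots> < e" using e m by simp
    finally show "norm (grid_quotient u n t - d) < e" .
  qed
qed

lemma norm_derivative_le_lipschitz:
  assumes d: "(u has_vector_derivative d) (at t within {0..T})" and t: "0 < t" "t < T"
    and lip: "\<And>s t. s \<in> {0..T} \<Longrightarrow> t \<in> {0..T} \<Longrightarrow> norm (u t - u s) \<le> M * \<bar>t - s\<bar>"
  shows "norm d \<le> M"
proof (rule field_le_epsilon)
  fix e :: real assume "e > 0"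
  then obtain \<delta> where \<delta>: "\<delta> > 0" and straddle: "\<And>y. y \<in> {0..T} \<Longrightarrow> \<bar>y - t\<bar> < \<delta> \<Longrightarrow>
      norm (u y - u t - (y - t) *\<^sub>R d) \<le> e * \<bar>y - t\<bar>"
    using d unfolding has_vector_derivative_def has_derivative_within_alt by (metis real_norm_def)
  define h where "h = min (\<delta> / 2) (T - t)"
  have h: "h > 0" "h < \<delta>" "t + h \<in> {0..T}" using \<delta> t by (auto simp: h_def min_def)
  have "norm (h *\<^sub>R d) \<le> norm (u (t + h) - u t) + norm (u (t + h) - u t - h *\<^sub>R d)"
    using norm_triangle_ineq4[of "u (t + h) - u t" "u (t + h) - u t - h *\<^sub>R d"] by simp
  also have "\<dots> \<le> M * h + e * h"
    using lip[of t "t + h"] straddle[of "t + h"] h t by (intro add_mono) auto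
  finally have "h * norm d \<le> h * (M + e)" using h by (simp add: algebra_simps)
  then show "norm d \<le> M + e" using h by simp
qed

lemma lipschitz_in_A2_arcs:
  assumes T: "T > 0"
    and lip: "\<And>s t. s \<in> {0..T} \<Longrightarrow> t \<in> {0..T} \<Longrightarrow> norm (u t - u s) \<le> M * \<bar>t - s\<bar>" and M: "M \<ge> 0"
    and Z: "countable Z"
    and deriv: "\<And>t. t \<in> {0<..<T} \<Longrightarrow> t \<notin> Z \<Longrightarrow> (u has_vector_derivative u' t) (at t within {0..T})"
  shows "u \<in> A2_arcs T"
    and "AE t in lebesgue_on {0..T}. t \<in> {0<..<T} \<and> t \<notin> Z \<and>
      vector_derivative u (at t within {0..T}) = u' t"
proof -
  let ?M = "lebesgue_on {0..T}"
  let ?d = "\<lambda>t. vector_derivative u (at t within {0..T})"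
  define Z' where "Z' = Z \<union> {0, T}"
  have Z': "countable Z'" using Z by (simp add: Z'_def)
  have good: "t \<in> {0<..<T} \<and> t \<notin> Z" if "t \<in> {0..T}" "t \<notin> Z'" for t
    using that by (auto simp: Z'_def)
  have vd: "?d t = u' t" if "t \<in> {0<..<T}" "t \<notin> Z" for t
    using vector_derivative_within_cbox[of 0 T t u "u' t"] deriv[OF that] that by simp
  have ae: "AE t in ?M. t \<in> {0..T} \<and> t \<notin> Z'"
  proof -
    have "AE t in ?M. t \<notin> Z'" by (rule AE_lebesgue_on_not_in_countable[OF Z']) simp
    moreover have "AE t in ?M. t \<in> {0..T}" using AE_space[of ?M] by simp
    ultimately show ?thesis by eventually_elim simp
  qed
  show "AE t in ?M. t \<in> {0<..<T} \<and> t \<notin> Z \<and> ?d t = u' t"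
    using ae by eventually_elim (use good vd in blast)
  have lim: "(\<lambda>n. grid_quotient u n t) \<longlonglongrightarrow> ?d t" if "t \<in> {0..T}" "t \<notin> Z'" for t
    using grid_quotient_tendsto[OF deriv, of t] good[OF that] vd[of t] by simp
  have "strongly_measurable ?M ?d"
    unfolding strongly_measurable_def
  proof (intro exI[of _ "grid_quotient u"] conjI allI)
    show "AE t in ?M. (\<lambda>n. grid_quotient u n t) \<longlonglongrightarrow> ?d t"
      using ae by eventually_elim (use lim in blast)
  qed (rule simple_function_grid_quotient)
  moreover have "integrable ?M (\<lambda>t. (norm (?d t))\<^sup>2)"
  proof -
    \<comment> \<open>Setting the value to 0 on the null set makes \<open>f\<close> an everywhere
      limit of measurable functions; completeness of Lebesgue measure then transfers measurability
      to the derivative.\<close>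
    define f where "f t = (if t \<in> {0..T} - Z' then (norm (?d t))\<^sup>2 else 0)" for t
    have Zm: "{0..T} - Z' \<in> sets lebesgue"
      using Z' by (intro sets.Diff) (auto intro: null_setsD2 null_sets_completionI countable_imp_null_set_lborel)
    have fm: "f \<in> borel_measurable ?M"
    proof (rule borel_measurable_LIMSEQ_real)
      let ?g = "\<lambda>n t. if t \<in> {0..T} - Z' then (norm (grid_quotient u n t))\<^sup>2 else 0"
      show "(\<lambda>n. ?g n t) \<longlonglongrightarrow> f t" for t
        using lim[of t] by (auto simp: f_def intro!: tendsto_intros)
      fix n
      have sf: "simple_function ?M (\<lambda>t. (norm (grid_quotient u n t))\<^sup>2)"
        by (rule simple_function_compose1[OF simple_function_grid_quotient, where g = "\<lambda>x. (norm x)\<^sup>2"])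
      show "?g n \<in> borel_measurable ?M"
      proof (rule measurable_If_set)
        show "(\<lambda>t. (norm (grid_quotient u n t))\<^sup>2) \<in> borel_measurable ?M"
          by (rule borel_measurable_simple_function[OF sf])
        show "({0..T} - Z') \<inter> space ?M \<in> sets ?M"
          using Zm by (auto simp: sets_restrict_space)
      qed simp
    qed
    have "(\<lambda>t. if t \<in> {0..T} then f t else 0) \<in> borel_measurable lebesgue"
      using fm by (subst borel_measurable_if) auto
    moreover have "AE t in lebesgue. (if t \<in> {0..T} then f t else 0) = (if t \<in> {0..T} then (norm (?d t))\<^sup>2 else 0)"
    proof -
      have "AE t in lebesgue. t \<notin> Z'"
        by (intro AE_completion AE_not_in countable_imp_null_set_lborel Z')
      then show ?thesis by eventually_elim (simp add: f_def)
    qed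
    ultimately have "(\<lambda>t. if t \<in> {0..T} then (norm (?d t))\<^sup>2 else 0) \<in> borel_measurable lebesgue"
      by (rule borel_measurable_AE)
    then have "(\<lambda>t. (norm (?d t))\<^sup>2) \<in> borel_measurable ?M"
      by (subst (asm) borel_measurable_if) auto
    moreover have "AE t in ?M. norm ((norm (?d t))\<^sup>2) \<le> M\<^sup>2"
      using ae
    proof eventually_elim
      case (elim t)
      then have t: "t \<in> {0<..<T}" "t \<notin> Z" using good by auto
      then have "norm (u' t) \<le> M"
        by (intro norm_derivative_le_lipschitz[OF deriv[OF t] _ _ lip]) auto
      then show ?case using vd[OF t] by (simp add: power_mono)
    qed
    ultimately show ?thesis
      by (intro finite_measure.integrable_const_bound[OF finite_measure_lebesgue_on]) auto
  qed
  ultimately have "square_integrable ?M ?d" by (simp add: square_integrable_def)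
  moreover have "AE t in ?M. u differentiable (at t within {0..T})"
    using ae by eventually_elim (use good deriv differentiableI_vector in blast)
  ultimately show "u \<in> A2_arcs T"
    using lipschitz_imp_absolutely_continuous_arc[OF lip M] by (simp add: A2_arcs_def)
qed


section \<open>The evolution equation\<close>

lemma lsc_sequentially:
  assumes lsc: "lower_semicontinuous \<phi>" and X: "X \<longlonglongrightarrow> x"
    and le: "\<And>n. \<phi> (X n) \<le> ereal (g n)" and g: "g \<longlonglongrightarrow> r"
  shows "\<phi> x \<le> ereal r"
proof (rule ccontr)
  assume "\<not> \<phi> x \<le> ereal r"
  then obtain c where c: "ereal r < ereal c" "ereal c < \<phi> x" using ereal_dense2 by (metis not_le)
  then have "ereal c < Liminf (at x) \<phi>"
    using lsc unfolding lower_semicontinuous_def by (metis less_le_trans)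
  then have "\<forall>\<^sub>F y in at x. ereal c < \<phi> y" by (rule less_LiminfD)
  \<comment> \<open>\<open>Liminf (at x)\<close> ignores the point \<open>x\<close>, which the
    sequence may hit; there \<open>c < \<phi> x\<close> applies.\<close>
  then have "\<forall>\<^sub>F y in nhds x. ereal c < \<phi> y" using c by (simp add: eventually_nhds_conv_at)
  then have "\<forall>\<^sub>F n in sequentially. ereal c < \<phi> (X n)"
    by (rule eventually_compose_filterlim[OF _ X])
  moreover have "\<forall>\<^sub>F n in sequentially. g n < c" using order_tendstoD(2)[OF g] c by simp
  ultimately have "\<forall>\<^sub>F n in sequentially. False"
  proof eventually_elim
    case (elim n)
    then have "ereal c < ereal (g n)" using le[of n] by (metis less_le_trans)
    then show False using elim by simp
  qed
  then show False by simp
qed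

text \<open>Density of \<open>D\<close> makes the adjoint vector \<open>z\<close> unique, so the
  description in \<open>adjoint_operator\<close> denotes it and \<open>z = - A y\<close>.\<close>

lemma antisymmetric_operator_skew:
  assumes A: "antisymmetric_operator D A" and x: "x \<in> D" and y: "y \<in> D"
  shows "A x \<bullet> y = - (x \<bullet> A y)"
proof -
  have dense: "closure D = UNIV" and "y \<in> adjoint_domain D A" and adj: "adjoint_operator D A y = - A y"
    using A y by (auto simp: antisymmetric_operator_def)
  then obtain z where z: "\<forall>x\<in>D. A x \<bullet> y = x \<bullet> z" by (auto simp: adjoint_domain_def)
  have "w = z" if w: "\<forall>x\<in>D. A x \<bullet> y = x \<bullet> w" for w
  proof -
    have "closed {x. x \<bullet> (w - z) = 0}" by (intro closed_Collect_eq continuous_intros)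
    moreover have "D \<subseteq> {x. x \<bullet> (w - z) = 0}" using w z by (auto simp: inner_diff_right)
    ultimately have "closure D \<subseteq> {x. x \<bullet> (w - z) = 0}" by (rule closure_minimal[rotated])
    then have "(w - z) \<bullet> (w - z) = 0" using dense by blast
    then show ?thesis by simp
  qed
  then have "adjoint_operator D A y = z"
    unfolding adjoint_operator_def using z by (intro the_equality) auto
  then have "z = - A y" using adj by simp
  then show ?thesis using z x by simp
qed

locale convex_skew =
  fixes \<phi> :: "'a::{real_inner, complete_space} \<Rightarrow> ereal" and A :: "'a \<Rightarrow> 'a" and x0 :: 'a
  assumes conv: "ereal_convex \<phi>" and lsc: "lower_semicontinuous \<phi>" and proper: "proper \<phi>"
    and skew: "\<And>x y. x \<in> effective_domain \<phi> \<Longrightarrow> y \<in> effective_domain \<phi> \<Longrightarrow> A x \<bullet> y = - (x \<bullet> A y)"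
    and sub0: "subdifferential \<phi> x0 \<noteq> {}"
begin

abbreviation "f x \<equiv> real_of_ereal (\<phi> x)"

lemma finite_on_domain: "x \<in> effective_domain \<phi> \<Longrightarrow> \<phi> x = ereal (f x)"
  using proper by (cases "\<phi> x") (auto simp: effective_domain_def proper_def)

lemma in_domain: "\<phi> x \<le> ereal r \<Longrightarrow> x \<in> effective_domain \<phi> \<and> f x \<le> r"
  using proper by (cases "\<phi> x") (auto simp: effective_domain_def proper_def)

text \<open>Off the effective domain \<open>\<phi> y\<close> is infinite and the inequality is
  trivial, so subgradients can be tested in real arithmetic.\<close>

lemma subdifferential_iff:
  "p \<in> subdifferential \<phi> x \<longleftrightarrow>
    x \<in> effective_domain \<phi> \<and> (\<forall>y\<in>effective_domain \<phi>. f x + p \<bullet> (y - x) \<le> f y)"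
proof (cases "x \<in> effective_domain \<phi>")
  case True
  have "\<phi> x + ereal (p \<bullet> (y - x)) \<le> \<phi> y \<longleftrightarrow> (y \<in> effective_domain \<phi> \<longrightarrow> f x + p \<bullet> (y - x) \<le> f y)" for y
  proof (cases "y \<in> effective_domain \<phi>")
    case y: True
    show ?thesis using finite_on_domain[OF True] finite_on_domain[OF y] y
      by (metis ereal_less_eq(3) plus_ereal.simps(1))
  next
    case False
    then have "\<phi> y = \<infinity>" by (simp add: effective_domain_def)
    then show ?thesis using False by simp
  qed
  then show ?thesis using True by (auto simp: subdifferential_def)
qed (simp add: subdifferential_def)

lemma skew_self: "x \<in> effective_domain \<phi> \<Longrightarrow> A x \<bullet> x = 0"
  using skew[of x x] by (simp add: inner_commute)

lemma convex_combination:
  assumes x: "x \<in> effective_domain \<phi>" and y: "y \<in> effective_domain \<phi>" and s: "0 < s" "s < 1"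
  shows "x + s *\<^sub>R (y - x) \<in> effective_domain \<phi> \<and> f (x + s *\<^sub>R (y - x)) \<le> (1 - s) * f x + s * f y"
proof (rule in_domain)
  have "x + s *\<^sub>R (y - x) = (1 - s) *\<^sub>R x + s *\<^sub>R y" by (simp add: algebra_simps)
  then have "\<phi> (x + s *\<^sub>R (y - x)) \<le> ereal (1 - s) * \<phi> x + ereal s * \<phi> y"
    using conv s by (simp add: ereal_convex_def)
  then show "\<phi> (x + s *\<^sub>R (y - x)) \<le> ereal ((1 - s) * f x + s * f y)"
    by (metis finite_on_domain[OF x] finite_on_domain[OF y] times_ereal.simps(1) plus_ereal.simps(1))
qed

text \<open>Monotonicity: adding the two subgradient inequalities leaves
  \<open>(A x - A y) \<bullet> (x - y)\<close>, whose diagonal terms vanish and whose cross terms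
  cancel by skewness.\<close>

lemma maximal_monotone_subdifferential_minus_skew: "maximal_monotone (\<lambda>x. {q. q + A x \<in> subdifferential \<phi> x})"
proof
  fix p q x y
  assume "p \<in> {q. q + A x \<in> subdifferential \<phi> x}" "q \<in> {q. q + A y \<in> subdifferential \<phi> y}"
  then have x: "x \<in> effective_domain \<phi>" and y: "y \<in> effective_domain \<phi>"
    and 1: "f x + (p + A x) \<bullet> (y - x) \<le> f y" and 2: "f y + (q + A y) \<bullet> (x - y) \<le> f x"
    by (auto simp: subdifferential_iff)
  have "(A x - A y) \<bullet> (x - y) = 0"
    using skew[OF x y] skew_self[OF x] skew_self[OF y]
    by (simp add: inner_diff_left inner_diff_right inner_commute)
  moreover have "(p + A x) \<bullet> (y - x) + (q + A y) \<bullet> (x - y)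
      = - ((p - q) \<bullet> (x - y)) - (A x - A y) \<bullet> (x - y)"
    by (simp add: inner_diff_left inner_diff_right inner_add_left)
  ultimately show "0 \<le> (p - q) \<bullet> (x - y)" using 1 2 by linarith
next
  fix \<mu> :: real and z assume mu: "\<mu> > 0"
  obtain p where p: "p \<in> subdifferential \<phi> x0" using sub0 by blast
  have "\<exists>x\<in>effective_domain \<phi>. \<forall>y\<in>effective_domain \<phi>.
      f x + ((1/\<mu>) *\<^sub>R (z - x) + A x) \<bullet> (y - x) \<le> f y"
  proof (rule monotone_skew_range[OF mu])
    show "effective_domain \<phi> \<noteq> {}" using proper by (simp add: proper_def)
    \<comment> \<open>The subgradient at \<open>x0\<close> supplies the affine minorant.\<close>
    show "(f x0 - p \<bullet> x0) + p \<bullet> x \<le> f x" if "x \<in> effective_domain \<phi>" for x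
      using p that by (auto simp: subdifferential_iff inner_diff_right)
    fix X x g r
    assume X: "\<And>n. X n \<in> effective_domain \<phi>" "X \<longlonglongrightarrow> x" "\<And>n. f (X n) \<le> g n" "g \<longlonglongrightarrow> r"
    have "\<phi> (X n) \<le> ereal (g n)" for n
      using X(3)[of n] finite_on_domain[OF X(1), of n] by (metis ereal_less_eq(3))
    then show "x \<in> effective_domain \<phi> \<and> f x \<le> r"
      using in_domain lsc_sequentially[OF lsc X(2) _ X(4)] by blast
  qed (use convex_combination skew in blast)+
  then obtain x where "(1/\<mu>) *\<^sub>R (z - x) + A x \<in> subdifferential \<phi> x"
    by (auto simp: subdifferential_iff)
  then show "\<exists>x. \<exists>p\<in>{q. q + A x \<in> subdifferential \<phi> x}. x + \<mu> *\<^sub>R p = z"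
    using mu by (intro exI[of _ x] bexI[of _ "(1/\<mu>) *\<^sub>R (z - x)"]) auto
qed

lemma evolution:
  fixes \<omega> T :: real
  assumes T: "T > 0"
  shows "\<exists>u \<in> A2_arcs T.
      (AE t in lebesgue_on {0..T}.
        - vector_derivative u (at t within {0..T}) + A (u t) - \<omega> *\<^sub>R u t
          \<in> subdifferential \<phi> (u t)) \<and>
      u 0 = x0"
proof -
  obtain p where p: "p \<in> subdifferential \<phi> x0" using sub0 by blast
  interpret maximal_monotone "\<lambda>x. {q. q + A x \<in> subdifferential \<phi> x}" 
    by (rule maximal_monotone_subdifferential_minus_skew)
  interpret implicit_euler "\<lambda>x. {q. q + A x \<in> subdifferential \<phi> x}" \<omega> x0 "p - A x0" T
    by unfold_locales (use p T in auto)
  have lip: "norm (trajectory t - trajectory s) \<le> M * \<bar>t - s\<bar>" if "s \<in> {0..T}" "t \<in> {0..T}" for s t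
    using trajectory_lipschitz[of s t] that by simp
  note arc = lipschitz_in_A2_arcs[OF T _ constants_nonneg(1) countable_exceptional_times,
      of trajectory "\<lambda>t. - velocity t"]
  have in_A2: "trajectory \<in> A2_arcs T"
    by (rule arc(1)) (rule lip trajectory_has_derivative, assumption+)+
  have deriv: "AE t in lebesgue_on {0..T}. t \<in> {0<..<T} \<and> t \<notin> exceptional_times \<and>
      vector_derivative trajectory (at t within {0..T}) = - velocity t"
    by (rule arc(2)) (rule lip trajectory_has_derivative, assumption+)+
  show ?thesis
  proof (intro bexI[OF _ in_A2] conjI)
    show "AE t in lebesgue_on {0..T}.
        - vector_derivative trajectory (at t within {0..T}) + A (trajectory t) - \<omega> *\<^sub>R trajectory t
          \<in> subdifferential \<phi> (trajectory t)"
      using deriv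
    proof eventually_elim
      case (elim t)
      \<comment> \<open>Membership in the operator means \<open>velocity t - \<omega> *\<^sub>R u +
        A u \<in> subdifferential \<phi> u\<close> for \<open>u = trajectory t\<close>, and the
        derivative is \<open>- velocity t\<close>.\<close>
      then show ?case using velocity_in[of t] by (simp add: algebra_simps)
    qed
  qed (auto simp: trajectory_0)
qed

end

theorem corollary5p1:
  fixes \<phi> :: "'a::{real_inner, complete_space} \<Rightarrow> ereal"
    and A :: "'a \<Rightarrow> 'a" and D :: "'a set" and x\<^sub>0 :: 'a
  assumes "ereal_convex \<phi>" and "lower_semicontinuous \<phi>" and "proper \<phi>"
    and "antisymmetric_operator D A"
    and "effective_domain \<phi> \<subseteq> D"
    and "x\<^sub>0 \<in> D" and "subdifferential \<phi> x\<^sub>0 \<noteq> {}"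
  shows "\<forall>(\<omega>::real) (T::real). T > 0 \<longrightarrow>
    (\<exists>u \<in> A2_arcs T.
      (AE t in lebesgue_on {0..T}.
        - vector_derivative u (at t within {0..T}) + A (u t) - \<omega> *\<^sub>R u t
          \<in> subdifferential \<phi> (u t)) \<and>
      u 0 = x\<^sub>0)"
proof -
  interpret convex_skew \<phi> A x\<^sub>0
    by unfold_locales (use assms antisymmetric_operator_skew[OF assms(4)] in auto)
  show ?thesis using evolution by blast
qed

end
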